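(* There exists a convergent Dirichlet series $\varphi \colon \mathbb{C}_0 \to \mathbb{C}_0$ which induces a bounded composition operator $C_\varphi \colon \mathcal{A}^+ \to \mathcal{A}^+$, $C_\varphi(f) = f \circ \varphi$, but such that $\varphi \notin \mathcal{A}^+$. Moreover, $\varphi$ can be chosen such that, in addition, $\varphi \in \mathscr{H}^p$ for all $1 \leq p < \infty$, and $C_\varphi \colon \mathcal{A}^+ \to \mathcal{A}^+$ is compact and absolutely summing.
   Context: For $\theta \in \mathbb{R}$, $\mathbb{C}_\theta = \{ z \in \mathbb{C} : \operatorname{Re} z > \theta \}$. A function $\varphi \colon \mathbb{C}_0 \to \mathbb{C}$ is called a convergent Dirichlet series if $\varphi$ is analytic on $\mathbb{C}_0$ and there are coefficients $a_n \in \mathbb{C}$ such that $\varphi(s) = \sum_{n=1}^\infty a_n n^{-s}$ (convergent series) for $\operatorname{Re} s$ large enough. The Wiener algebra of Dirichlet series $\mathcal{A}^+$ is the Banach space of all analytic functions $f \colon \mathbb{C}_0 \to \mathbb{C}$ which can be written $f(s) = \sum_{n=1}^\infty a_n n^{-s}$ on $\mathbb{C}_0$ with $\|f\|_{\mathcal{A}^+} := \sum_{n=1}^\infty |a_n| < +\infty$. For an analytic map $\varphi \colon \mathbb{C}_0 \to \mathbb{C}_0$, saying that $\varphi$ induces a bounded composition operator $C_\varphi \colon \mathcal{A}^+ \to \mathcal{A}^+$ means that $f \circ \varphi \in \mathcal{A}^+$ for every $f \in \mathcal{A}^+$ and that the linear map $C_\varphi(f) = f \circ \varphi$ is bounded on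 $\mathcal{A}^+$. Hardy spaces of Dirichlet series: let $(p_j)_{j \geq 1}$ be the increasing sequence of all prime numbers. To a Dirichlet series $\varphi(s) = \sum_{n=1}^\infty a_n n^{-s}$ one associates the (formal) Taylor series in infinitely many variables $(\Delta \varphi)(z) = \sum_{\alpha} a_n z_1^{\alpha_1} z_2^{\alpha_2} \cdots z_r^{\alpha_r}$, where $n = p_1^{\alpha_1} p_2^{\alpha_2} \cdots p_r^{\alpha_r}$ is the prime factorization of $n$ and $\alpha = (\alpha_1, \ldots, \alpha_r, 0, 0, \ldots)$. For $1 \leq p < \infty$, $H^p(\mathbb{T}^\infty)$ is the subspace of $L^p(\mathbb{T}^\infty)$ (with respect to normalized Haar measure) of the functions whose Fourier coefficients vanish outside the finitely supported sequences of non-negative integers. The space $\mathscr{H}^p$ is the space of all convergent Dirichlet series $\varphi$ for which $\Delta \varphi$ belongs to $H^p(\mathbb{T}^\infty)$ (i.e. is the Fourier series of an element of $H^p(\mathbb{T}^\infty)$), with norm $\|\varphi\|_{\mathscr{H}^p} = \|\Delta\varphi\|_{H^p}$. A bounded linear map $u \colon X \to Y$ between Banach spaces is absolutely summing (i.e. $1$-summing) if there is a constant $K > 0$ such that $\sum_{k=1}^n \|u(x_k)\| \leq K \sup_{\xi \in B_{X^*}} \sum_{k=1}^n |\xi(x_k)|$ for all $n \geq 1$ and all $x_1, \ldots, x_n \in X$, where $B_{X^*}$ is the unit ball of the dual $X^*$. *)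

theory Defs
  imports "HOL-Probability.Probability"
begin

section \<open>Complex normed spaces, compact and absolutely summing operators\<close>

text \<open>
  The library only has real normed spaces. The dual space in the definition of absolutely summing
  operators is the space of complex linear functionals, so scalar multiplication by complex numbers
  is added here.
\<close>

class complex_normed_vector = real_normed_vector +
  fixes scaleC :: "complex \<Rightarrow> 'a \<Rightarrow> 'a" (infixr \<open>*\<^sub>C\<close> 75)
  assumes scaleC_add_right: "c *\<^sub>C (x + y) = c *\<^sub>C x + c *\<^sub>C y"
    and scaleC_add_left: "(c + d) *\<^sub>C x = c *\<^sub>C x + d *\<^sub>C x"
    and scaleC_scaleC: "c *\<^sub>C d *\<^sub>C x = (c * d) *\<^sub>C x"
    and scaleR_scaleC: "r *\<^sub>R x = complex_of_real r *\<^sub>C x"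
    and norm_scaleC: "norm (c *\<^sub>C x) = cmod c * norm x"

instantiation complex :: complex_normed_vector
begin

definition scaleC_complex :: "complex \<Rightarrow> complex \<Rightarrow> complex" where
  "scaleC_complex c x = c * x"

instance
  by standard (auto simp: scaleC_complex_def algebra_simps norm_mult scaleR_conv_of_real)

end

definition bounded_clinear :: "('a::complex_normed_vector \<Rightarrow> 'b::complex_normed_vector) \<Rightarrow> bool" where
  "bounded_clinear u \<longleftrightarrow> bounded_linear u \<and> (\<forall>c x. u (c *\<^sub>C x) = c *\<^sub>C u x)"

definition dual_unit_ball :: "('a::complex_normed_vector \<Rightarrow> complex) set" where
  "dual_unit_ball = {\<xi>. bounded_clinear \<xi> \<and> onorm \<xi> \<le> 1}"

definition compact_operator :: "('a::complex_normed_vector \<Rightarrow> 'b::complex_normed_vector) \<Rightarrow> bool" where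
  "compact_operator u \<longleftrightarrow> bounded_clinear u \<and> compact (closure (u ` cball 0 1))"

text \<open>
  The supremum is one of real numbers; it is taken over a nonempty set which is bounded above by
  the sum of the norms of the \<open>x k\<close>.
\<close>

definition absolutely_summing ::
    "('a::complex_normed_vector \<Rightarrow> 'b::complex_normed_vector) \<Rightarrow> bool" where
  "absolutely_summing u \<longleftrightarrow> bounded_clinear u \<and>
     (\<exists>K>0. \<forall>n\<ge>1. \<forall>x :: nat \<Rightarrow> 'a.
        (\<Sum>k=1..n. norm (u (x k))) \<le> K * (SUP \<xi>\<in>dual_unit_ball. \<Sum>k=1..n. cmod (\<xi> (x k))))"


section \<open>Dirichlet series\<close>

definition halfplane :: "real \<Rightarrow> complex set" where
  "halfplane \<theta> = {z. \<theta> < Re z}"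

text \<open>
  The series with coefficients \<open>a 1, a 2, \<dots>\<close> converges to \<open>v\<close> at \<open>s\<close>; the value \<open>a 0\<close> is not used.
\<close>

definition dirichlet_sums :: "(nat \<Rightarrow> complex) \<Rightarrow> complex \<Rightarrow> complex \<Rightarrow> bool" where
  "dirichlet_sums a s v \<longleftrightarrow> (\<lambda>n. a (Suc n) * of_nat (Suc n) powr (- s)) sums v"

text \<open>
  Functions on the half-plane \<open>halfplane 0\<close> are represented by total functions, whose values
  outside \<open>halfplane 0\<close> are irrelevant in the following predicates. The bound \<open>0 \<le> \<theta>\<close> keeps
  \<open>halfplane \<theta>\<close> inside the domain.
\<close>

definition dirichlet_expansion :: "(complex \<Rightarrow> complex) \<Rightarrow> (nat \<Rightarrow> complex) \<Rightarrow> bool" where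
  "dirichlet_expansion \<phi> a \<longleftrightarrow> (\<exists>\<theta>\<ge>0. \<forall>s\<in>halfplane \<theta>. dirichlet_sums a s (\<phi> s))"

definition convergent_dirichlet_series :: "(complex \<Rightarrow> complex) \<Rightarrow> bool" where
  "convergent_dirichlet_series \<phi> \<longleftrightarrow>
     \<phi> analytic_on halfplane 0 \<and> (\<exists>a. dirichlet_expansion \<phi> a)"


section \<open>The Wiener algebra of Dirichlet series\<close>

definition wiener_expansion :: "(complex \<Rightarrow> complex) \<Rightarrow> (nat \<Rightarrow> complex) \<Rightarrow> bool" where
  "wiener_expansion f a \<longleftrightarrow>
     summable (\<lambda>n. cmod (a (Suc n))) \<and> (\<forall>s\<in>halfplane 0. dirichlet_sums a s (f s))"

definition in_wiener_algebra :: "(complex \<Rightarrow> complex) \<Rightarrow> bool" where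
  "in_wiener_algebra f \<longleftrightarrow> f analytic_on halfplane 0 \<and> (\<exists>a. wiener_expansion f a)"

lemma wiener_expansion_zero: "wiener_expansion (\<lambda>_. 0) (\<lambda>_. 0)"
  by (simp add: wiener_expansion_def dirichlet_sums_def)

lemma wiener_expansion_add:
  assumes "wiener_expansion f a" "wiener_expansion g b"
  shows "wiener_expansion (\<lambda>s. f s + g s) (\<lambda>n. a n + b n)"
proof -
  have "summable (\<lambda>n. cmod (a (Suc n)) + cmod (b (Suc n)))"
    using assms by (intro summable_add) (auto simp: wiener_expansion_def)
  then have "summable (\<lambda>n. cmod (a (Suc n) + b (Suc n)))"
    by (rule summable_comparison_test') (simp add: norm_triangle_ineq)
  then show ?thesis
    using assms by (auto simp: wiener_expansion_def dirichlet_sums_def distrib_right intro: sums_add)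
qed

lemma wiener_expansion_scale:
  assumes "wiener_expansion f a"
  shows "wiener_expansion (\<lambda>s. c * f s) (\<lambda>n. c * a n)"
  using assms
  by (auto simp: wiener_expansion_def dirichlet_sums_def norm_mult mult.assoc
        intro: sums_mult summable_mult)

lemma dirichlet_coeff_zero:
  fixes b :: "nat \<Rightarrow> complex"
  assumes sb: "summable (\<lambda>n. cmod (b n))"
    and z: "\<And>N. N > 0 \<Longrightarrow> (\<lambda>n. b n * inverse (of_nat (Suc n)) ^ N) sums 0"
  shows "b m = 0"
proof (induction m rule: less_induct)
  case (less m)
  define q where "q = real (Suc m) / real (Suc (Suc m))"
  define S where "S = (\<Sum>n. cmod (b (n + Suc m)))"
  have q: "0 \<le> q" "q < 1" by (auto simp: q_def)
  have sb': "summable (\<lambda>n. cmod (b (n + Suc m)))"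
    using sb by (subst summable_iff_shift)
  have bound: "cmod (b m) \<le> S * q ^ N" if N: "N > 0" for N
  proof -
    let ?t = "\<lambda>n. b n * (of_nat (Suc m) / of_nat (Suc n)) ^ N"
    have "(\<lambda>n. of_nat (Suc m) ^ N * (b n * inverse (of_nat (Suc n)) ^ N)) sums 0"
      using sums_mult[OF z[OF N]] by force
    then have t: "?t sums 0"
      by (simp add: field_simps)
    have "(\<lambda>n. ?t (n + Suc m)) sums (0 - (\<Sum>n<Suc m. ?t n))"
      using t by (subst sums_iff_shift) auto
    also have "(\<Sum>n<Suc m. ?t n) = b m"
      using less by (simp del: of_nat_Suc)
    finally have u: "(\<lambda>n. ?t (n + Suc m)) sums (- b m)" by simp
    have le: "cmod (?t (n + Suc m)) \<le> cmod (b (n + Suc m)) * q ^ N" for n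
    proof -
      have "cmod (of_nat (Suc m) / of_nat (Suc (n + Suc m))) = real (Suc m) / real (Suc (n + Suc m))"
        by (simp add: norm_divide del: of_nat_Suc)
      also have "\<dots> \<le> q"
        unfolding q_def by (intro divide_left_mono) auto
      finally show ?thesis
        by (auto simp: norm_mult norm_power intro!: mult_left_mono power_mono simp del: of_nat_Suc)
    qed
    have sm: "summable (\<lambda>n. cmod (b (n + Suc m)) * q ^ N)"
      by (intro summable_mult2 sb')
    have "cmod (- b m) = cmod (\<Sum>n. ?t (n + Suc m))"
      using u by (simp add: sums_iff)
    also have "\<dots> \<le> (\<Sum>n. cmod (b (n + Suc m)) * q ^ N)"
      by (rule norm_suminf_le[OF le sm])
    also have "\<dots> = S * q ^ N"
      unfolding S_def by (rule suminf_mult2[symmetric, OF sb'])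
    finally show ?thesis by simp
  qed
  have "(\<lambda>N. S * q ^ N) \<longlonglongrightarrow> S * 0"
    by (intro tendsto_intros LIMSEQ_power_zero) (use q in auto)
  then have "cmod (b m) \<le> S * 0"
    by (rule tendsto_lowerbound) (auto intro!: eventually_sequentiallyI[of 1] bound)
  then show "b m = 0" by simp
qed

lemma wiener_expansion_zero_unique:
  assumes "wiener_expansion f a" "\<And>s. s \<in> halfplane 0 \<Longrightarrow> f s = 0"
  shows "a (Suc n) = 0"
proof (rule dirichlet_coeff_zero[where b = "\<lambda>n. a (Suc n)"])
  show "summable (\<lambda>n. cmod (a (Suc n)))"
    using assms by (simp add: wiener_expansion_def)
  fix N :: nat assume N: "N > 0"
  then have "of_nat N \<in> halfplane 0" by (simp add: halfplane_def)
  then have "(\<lambda>n. a (Suc n) * of_nat (Suc n) powr (- of_nat N)) sums 0"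
    using assms unfolding wiener_expansion_def dirichlet_sums_def by metis
  moreover have "of_nat (Suc n) powr (- of_nat N :: complex) = inverse (of_nat (Suc n)) ^ N" for n
    by (simp add: powr_minus powr_nat' power_inverse N del: of_nat_Suc)
  ultimately show "(\<lambda>n. a (Suc n) * inverse (of_nat (Suc n)) ^ N) sums 0" by simp
qed

lemma wiener_expansion_unique:
  assumes "wiener_expansion f a" "wiener_expansion f b" "a 0 = b 0"
  shows "a = b"
proof
  fix n
  have "wiener_expansion (\<lambda>s. f s + (-1) * f s) (\<lambda>n. a n + (-1) * b n)"
    using assms by (intro wiener_expansion_add wiener_expansion_scale)
  then have "a (Suc k) + (-1) * b (Suc k) = 0" for k
    by (rule wiener_expansion_zero_unique) auto
  then show "a n = b n"
    using assms(3) by (cases n) auto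
qed

text \<open>
  To obtain a normed space, functions are identified with their extensions by zero outside
  \<open>halfplane 0\<close>.
\<close>

typedef wiener = "{f. in_wiener_algebra f \<and> (\<forall>s. s \<notin> halfplane 0 \<longrightarrow> f s = 0)}"
  morphisms eval Abs_wiener
  by (rule exI[of _ "\<lambda>_. 0"])
    (auto simp: in_wiener_algebra_def intro: wiener_expansion_zero)

setup_lifting type_definition_wiener

lemma in_wiener_algebra_eval: "in_wiener_algebra (eval f)"
  and eval_outside: "s \<notin> halfplane 0 \<Longrightarrow> eval f s = 0"
  using eval[of f] by auto

definition wiener_coeff :: "wiener \<Rightarrow> nat \<Rightarrow> complex" where
  "wiener_coeff f = (THE a. a 0 = 0 \<and> wiener_expansion (eval f) a)"

lemma wiener_coeff_eqI:
  assumes "a 0 = 0" "wiener_expansion (eval f) a"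
  shows "wiener_coeff f = a"
  unfolding wiener_coeff_def
proof (rule the_equality)
  show "a 0 = 0 \<and> wiener_expansion (eval f) a" using assms by simp
  show "b = a" if "b 0 = 0 \<and> wiener_expansion (eval f) b" for b
    using that assms wiener_expansion_unique[of "eval f" b a] by simp
qed

lemma wiener_coeff:
  "wiener_coeff f 0 = 0" "wiener_expansion (eval f) (wiener_coeff f)"
proof -
  obtain a where "wiener_expansion (eval f) a"
    using in_wiener_algebra_eval by (auto simp: in_wiener_algebra_def)
  then have *: "wiener_expansion (eval f) (a(0 := 0))"
    by (simp add: wiener_expansion_def dirichlet_sums_def)
  then have "wiener_coeff f = a(0 := 0)"
    by (intro wiener_coeff_eqI) auto
  then show "wiener_coeff f 0 = 0" "wiener_expansion (eval f) (wiener_coeff f)"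
    using * by simp_all
qed

lemma summable_wiener_coeff: "summable (\<lambda>n. cmod (wiener_coeff f (Suc n)))"
  using wiener_coeff(2) by (simp add: wiener_expansion_def)

lift_definition zero_wiener_fun :: wiener is "\<lambda>_. 0"
  by (auto simp: in_wiener_algebra_def intro: wiener_expansion_zero)

lift_definition plus_wiener_fun :: "wiener \<Rightarrow> wiener \<Rightarrow> wiener" is "\<lambda>f g s. f s + g s"
  by (auto simp: in_wiener_algebra_def intro: wiener_expansion_add analytic_on_add)

lift_definition scale_wiener_fun :: "complex \<Rightarrow> wiener \<Rightarrow> wiener" is "\<lambda>c f s. c * f s"
  by (auto simp: in_wiener_algebra_def intro: wiener_expansion_scale analytic_on_mult)

instantiation wiener :: complex_normed_vector
begin

definition "0 = zero_wiener_fun"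
definition "f + g = plus_wiener_fun f g"
definition "c *\<^sub>C f = scale_wiener_fun c f"
definition "r *\<^sub>R f = scale_wiener_fun (complex_of_real r) f"
definition "- f = scale_wiener_fun (- 1) f"
definition "f - g = plus_wiener_fun f (scale_wiener_fun (- 1) g)"
definition norm_wiener :: "wiener \<Rightarrow> real" where
  "norm_wiener f = (\<Sum>n. cmod (wiener_coeff f (Suc n)))"
definition sgn_wiener :: "wiener \<Rightarrow> wiener" where
  "sgn_wiener f = inverse (norm f) *\<^sub>R f"
definition dist_wiener :: "wiener \<Rightarrow> wiener \<Rightarrow> real" where
  "dist_wiener f g = norm (f - g)"
definition uniformity_wiener :: "(wiener \<times> wiener) filter" where
  "uniformity_wiener = (INF e\<in>{0<..}. principal {(x, y). dist (x :: wiener) y < e})"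
definition open_wiener :: "wiener set \<Rightarrow> bool" where
  "open_wiener U \<longleftrightarrow> (\<forall>x\<in>U. \<forall>\<^sub>F (x', y) in uniformity. x' = x \<longrightarrow> y \<in> U)"

lemma eval_zero [simp]: "eval 0 s = 0"
  unfolding zero_wiener_def by transfer simp

lemma eval_add [simp]: "eval (f + g) s = eval f s + eval g s"
  unfolding plus_wiener_def by transfer simp

lemma eval_scaleC [simp]: "eval (c *\<^sub>C f) s = c * eval f s"
  unfolding scaleC_wiener_def by transfer simp

lemma eval_scaleR [simp]: "eval (r *\<^sub>R f) s = complex_of_real r * eval f s"
  unfolding scaleR_wiener_def by transfer simp

lemma eval_uminus [simp]: "eval (- f) s = - eval f s"
  unfolding uminus_wiener_def by transfer simp

lemma eval_diff [simp]: "eval (f - g) s = eval f s - eval g s"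
  unfolding minus_wiener_def by transfer simp

lemma wiener_eqI: "(\<And>s. eval f s = eval g s) \<Longrightarrow> f = g"
  by (metis eval_inject ext)

lemma wiener_coeff_add: "wiener_coeff (f + g) n = wiener_coeff f n + wiener_coeff g n"
proof -
  have "eval (f + g) = (\<lambda>s. eval f s + eval g s)" by (rule ext) simp
  then have "wiener_coeff (f + g) = (\<lambda>n. wiener_coeff f n + wiener_coeff g n)"
    by (intro wiener_coeff_eqI) (auto simp: wiener_coeff intro: wiener_expansion_add)
  then show ?thesis by simp
qed

lemma wiener_coeff_scaleC: "wiener_coeff (c *\<^sub>C f) n = c * wiener_coeff f n"
proof -
  have "eval (c *\<^sub>C f) = (\<lambda>s. c * eval f s)" by (rule ext) simp
  then have "wiener_coeff (c *\<^sub>C f) = (\<lambda>n. c * wiener_coeff f n)"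
    by (intro wiener_coeff_eqI) (auto simp: wiener_coeff intro: wiener_expansion_scale)
  then show ?thesis by simp
qed

instance
proof
  fix f g h :: wiener and r t :: real and c d :: complex
  show norm_C: "norm (c *\<^sub>C f) = cmod c * norm f" for c
    unfolding norm_wiener_def
    by (simp add: wiener_coeff_scaleC norm_mult suminf_mult summable_wiener_coeff)
  show R_C: "r *\<^sub>R f = complex_of_real r *\<^sub>C f" for r
    by (rule wiener_eqI) simp
  show "norm (r *\<^sub>R f) = \<bar>r\<bar> * norm f"
    by (simp add: R_C norm_C)
  show "norm (f + g) \<le> norm f + norm g"
  proof -
    have s: "summable (\<lambda>n. cmod (wiener_coeff f (Suc n)) + cmod (wiener_coeff g (Suc n)))"
      by (intro summable_add summable_wiener_coeff)
    have "norm (f + g) \<le> (\<Sum>n. cmod (wiener_coeff f (Suc n)) + cmod (wiener_coeff g (Suc n)))"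
      unfolding norm_wiener_def
      by (intro suminf_le summable_wiener_coeff s) (simp add: wiener_coeff_add norm_triangle_ineq)
    then show ?thesis
      unfolding norm_wiener_def by (simp add: suminf_add summable_wiener_coeff)
  qed
  show "norm f = 0 \<longleftrightarrow> f = 0"
  proof
    assume "norm f = 0"
    then have "cmod (wiener_coeff f (Suc n)) = 0" for n
      unfolding norm_wiener_def using suminf_eq_zero_iff[OF summable_wiener_coeff] by auto
    then have "eval f s = 0" for s
      using wiener_coeff(2)[of f] eval_outside[of s f] sums_unique2[OF _ sums_zero]
      by (cases "s \<in> halfplane 0") (auto simp: wiener_expansion_def dirichlet_sums_def)
    then show "f = 0" by (intro wiener_eqI) simp
  next
    assume "f = 0"
    then have "f = 0 *\<^sub>C f" by (intro wiener_eqI) simp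
    then show "norm f = 0" using norm_C[of 0] by simp
  qed
qed (auto intro!: wiener_eqI simp: algebra_simps sgn_wiener_def dist_wiener_def
       uniformity_wiener_def open_wiener_def)

end


section \<open>Composition operators on the Wiener algebra\<close>

text \<open>
  This is meaningful if \<open>\<phi>\<close> maps \<open>halfplane 0\<close> to itself and all compositions
  belong to the Wiener algebra.
\<close>

definition composition_operator :: "(complex \<Rightarrow> complex) \<Rightarrow> wiener \<Rightarrow> wiener" where
  "composition_operator \<phi> f = Abs_wiener (\<lambda>s. if s \<in> halfplane 0 then eval f (\<phi> s) else 0)"

definition induces_bounded_composition_operator :: "(complex \<Rightarrow> complex) \<Rightarrow> bool" where
  "induces_bounded_composition_operator \<phi> \<longleftrightarrow>
     (\<forall>f. in_wiener_algebra f \<longrightarrow> in_wiener_algebra (f \<circ> \<phi>)) \<and>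
     bounded_clinear (composition_operator \<phi>)"

lemma eval_composition_operator:
  assumes "\<forall>f. in_wiener_algebra f \<longrightarrow> in_wiener_algebra (f \<circ> \<phi>)" and "s \<in> halfplane 0"
  shows "eval (composition_operator \<phi> f) s = eval f (\<phi> s)"
proof -
  let ?g = "\<lambda>s. if s \<in> halfplane 0 then eval f (\<phi> s) else 0"
  have comp: "in_wiener_algebra (eval f \<circ> \<phi>)"
    using assms(1) in_wiener_algebra_eval by blast
  have "open (halfplane 0)"
    unfolding halfplane_def by (rule open_halfspace_Re_gt)
  then have "?g analytic_on halfplane 0"
    using comp by (auto simp: in_wiener_algebra_def analytic_on_open cong: holomorphic_cong)
  then have "in_wiener_algebra ?g"
    using comp by (auto simp: in_wiener_algebra_def wiener_expansion_def)
  then have "eval (Abs_wiener ?g) = ?g"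
    by (intro Abs_wiener_inverse) auto
  then show ?thesis
    using assms(2) by (simp add: composition_operator_def)
qed


section \<open>Hardy spaces of Dirichlet series\<close>

text \<open>
  Normalized Haar measure on the circle is the image of the uniform distribution on \<open>[0,1]\<close>
  under \<open>t \<mapsto> exp (2 \<pi> i t)\<close>; on the infinite torus it is the product measure.
\<close>

definition circle_measure :: "complex measure" where
  "circle_measure =
     distr (uniform_measure lborel {0..1}) (restrict_space borel (sphere 0 1)) (\<lambda>t. cis (2 * pi * t))"

definition torus_measure :: "(nat \<Rightarrow> complex) measure" where
  "torus_measure = (\<Pi>\<^sub>M j\<in>UNIV. circle_measure)"

lemma prob_space_circle_measure: "prob_space circle_measure"
proof -
  interpret U: prob_space "uniform_measure lborel {0..1::real}"
    by (rule prob_space_uniform_measure) auto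
  have cont: "continuous_on UNIV (\<lambda>t. cis (2 * pi * t))"
    unfolding cis_conv_exp by (intro continuous_intros)
  show ?thesis
    unfolding circle_measure_def
    by (intro U.prob_space_distr measurable_restrict_space2)
      (auto intro!: borel_measurable_continuous_onI cont simp: measurable_cong_sets[OF sets_uniform_measure refl])
qed

lemma prob_space_torus_measure: "prob_space torus_measure"
  unfolding torus_measure_def by (intro prob_space_PiM prob_space_circle_measure)

text \<open>
  The characters of the infinite torus are indexed by the finitely supported integer sequences.
\<close>

definition finitely_supported :: "(nat \<Rightarrow> int) \<Rightarrow> bool" where
  "finitely_supported \<alpha> \<longleftrightarrow> finite {j. \<alpha> j \<noteq> 0}"

definition torus_character :: "(nat \<Rightarrow> int) \<Rightarrow> (nat \<Rightarrow> complex) \<Rightarrow> complex" where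
  "torus_character \<alpha> z = (\<Prod>j | \<alpha> j \<noteq> 0. z j powi \<alpha> j)"

definition fourier_coeff :: "((nat \<Rightarrow> complex) \<Rightarrow> complex) \<Rightarrow> (nat \<Rightarrow> int) \<Rightarrow> complex" where
  "fourier_coeff F \<alpha> = (\<integral>z. F z * cnj (torus_character \<alpha> z) \<partial>torus_measure)"

definition lp_torus :: "real \<Rightarrow> ((nat \<Rightarrow> complex) \<Rightarrow> complex) set" where
  "lp_torus p = {F \<in> borel_measurable torus_measure.
     integrable torus_measure (\<lambda>z. cmod (F z) powr p)}"

definition hp_torus :: "real \<Rightarrow> ((nat \<Rightarrow> complex) \<Rightarrow> complex) set" where
  "hp_torus p = {F \<in> lp_torus p.
     \<forall>\<alpha>. finitely_supported \<alpha> \<and> \<not> (\<forall>j. 0 \<le> \<alpha> j) \<longrightarrow> fourier_coeff F \<alpha> = 0}"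

text \<open>
  Primes are counted from index 0, so \<open>prime_exponents n j\<close> is the exponent of the \<open>(j+1)\<close>-st prime
  in \<open>n\<close>. For \<open>n \<ge> 1\<close> these sequences are exactly the finitely supported sequences of
  non-negative integers, each occurring once.
\<close>

definition prime_exponents :: "nat \<Rightarrow> nat \<Rightarrow> int" where
  "prime_exponents n j = int (multiplicity (enumerate {p::nat. prime p} j) n)"

definition in_hardy_dirichlet :: "real \<Rightarrow> (complex \<Rightarrow> complex) \<Rightarrow> bool" where
  "in_hardy_dirichlet p \<phi> \<longleftrightarrow> convergent_dirichlet_series \<phi> \<and>
     (\<exists>a. dirichlet_expansion \<phi> a \<and>
       (\<exists>F\<in>hp_torus p. \<forall>n\<ge>1. fourier_coeff F (prime_exponents n) = a n))"

end

theory Submission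
  imports Defs "HOL-Complex_Analysis.Complex_Analysis"
begin

text \<open>
  The symbol is \<open>\<phi>(s) = 3 - Ln (1 - 2 powr (-s))\<close>. Then \<open>n powr (-\<phi>)\<close> is \<open>n powr (-3)\<close> times the binomial
  series \<open>(1 - 2 powr (-s)) powr (ln n)\<close>, whose coefficients have absolute sum at most \<open>2 * 2 powr (ln n)\<close>.
  So the norms of the images of the monomials are at most \<open>2 / n\<^sup>2\<close>, and the composition operator is the
  absolutely convergent sum of the rank one operators sending \<open>f\<close> to its \<open>n\<close>-th coefficient times
  \<open>n powr (-\<phi>)\<close>; this gives boundedness, compactness and absolute summability. The symbol is unbounded
  near \<open>0\<close>, hence not in the algebra, but its singularity \<open>Ln (1 - z)\<close> on the circle is only logarithmic,
  hence in every \<open>L\<^sup>p\<close>.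
\<close>

section \<open>Absolutely convergent double series\<close>

text \<open>The symbol is made unbounded only towards the right: near \<open>z = 1\<close>, with
  \<open>z = 2 powr (- s)\<close>, its real part tends to infinity while its imaginary part stays
  bounded, so \<open>n powr (- \<phi>)\<close> tends to 0 there for \<open>n \<ge> 2\<close> instead
  of oscillating. The logarithm is the choice that turns these powers into
  \<open>(1 - z) powr (ln n)\<close>, whose Taylor coefficients are explicit and whose absolute sums
  can be estimated. Since \<open>s\<close> enters only through \<open>z\<close>, all expansions are
  power series in one variable, and on the torus only the coordinate of the prime 2 occurs. The
  constant 3 pays for two things. The binomial estimate costs a factor
  \<open>2 powr ln n = n powr ln 2 \<le> n\<close>, and 3 leaves the summable
  \<open>n powr (- 2)\<close>. Moreover \<open>cmod (1 - z) < 2\<close> keeps the real part of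
  \<open>\<phi>\<close> above \<open>3 - ln 2\<close>, hence positive.\<close>

lemma double_series_swap:
  fixes g :: "nat \<Rightarrow> nat \<Rightarrow> 'a::banach"
  assumes row: "\<And>n. summable (\<lambda>k. norm (g n k))"
    and rows: "summable (\<lambda>n. \<Sum>k. norm (g n k))"
  shows "summable (\<lambda>n. norm (g n k))"
    and "summable (\<lambda>k. norm (\<Sum>n. g n k))"
    and "(\<Sum>k. norm (\<Sum>n. g n k)) \<le> (\<Sum>n. \<Sum>k. norm (g n k))"
    and "(\<lambda>k. \<Sum>n. g n k) sums (\<Sum>n. \<Sum>k. g n k)"
proof -
  have nonneg: "0 \<le> (\<Sum>k. norm (g n k))" for n
    by (intro suminf_nonneg row) simp
  show col: "summable (\<lambda>n. norm (g n k))" for k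
    by (rule summable_comparison_test'[OF rows])
      (use sum_le_suminf[OF row, of "{k}"] in auto)
  \<comment> \<open>The exchange is carried out for unordered sums over
    \<open>UNIV \<times> UNIV\<close>; this fact and the next translate between them and ordered
    series.\<close>
  have abs_summable_nat: "(\<lambda>n. norm (f n)) summable_on UNIV \<longleftrightarrow> summable (\<lambda>n. norm (f n))"
    for f :: "nat \<Rightarrow> 'b::real_normed_vector"
    using summable_on_UNIV_nonneg_real_iff[of "\<lambda>n. norm (f n)"] by simp
  have infsum_norm: "(\<Sum>\<^sub>\<infinity>k. f k) = (\<Sum>k. f k)" if "summable (\<lambda>k. norm (f k))"
    for f :: "nat \<Rightarrow> 'b::banach"
    using norm_summable_imp_has_sum[OF that summable_sums[OF summable_norm_cancel[OF that]]]
    by (rule infsumI)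
  have "(\<lambda>x. norm (case x of (n, k) \<Rightarrow> g n k)) summable_on (UNIV \<times> UNIV)"
    by (rule Infinite_Sum.abs_summable_on_Sigma_iff[THEN iffD2])
      (auto simp: abs_summable_nat row rows infsum_norm nonneg summable_on_UNIV_nonneg_real_iff)
  then have prod: "(\<lambda>(n, k). norm (g n k)) summable_on (UNIV \<times> UNIV)"
    by (simp add: case_prod_unfold)
  then have "(\<lambda>(k, n). norm (g n k)) summable_on (UNIV \<times> UNIV)"
    by (subst summable_on_swap) simp
  then have "(\<lambda>x. norm (case x of (k, n) \<Rightarrow> g n k)) summable_on (UNIV \<times> UNIV)"
    by (simp add: case_prod_unfold)
  from Infinite_Sum.abs_summable_on_Sigma_iff[THEN iffD1, OF this]
  have cols: "summable (\<lambda>k. \<Sum>n. norm (g n k))"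
    by (auto simp: abs_summable_nat col infsum_norm suminf_nonneg summable_on_UNIV_nonneg_real_iff)
  have le: "norm (\<Sum>n. g n k) \<le> (\<Sum>n. norm (g n k))" for k
    by (rule summable_norm[OF col])
  show sm: "summable (\<lambda>k. norm (\<Sum>n. g n k))"
    by (rule summable_comparison_test'[OF cols]) (use le in auto)
  have row_norms: "summable (\<lambda>n. norm (\<Sum>k. g n k))"
    by (rule summable_comparison_test'[OF rows]) (use summable_norm[OF row] in auto)
  have "(\<Sum>k. norm (\<Sum>n. g n k)) \<le> (\<Sum>k. \<Sum>n. norm (g n k))"
    by (intro suminf_le le sm cols)
  also have "\<dots> = (\<Sum>\<^sub>\<infinity>k. \<Sum>\<^sub>\<infinity>n. norm (g n k))"
    using cols by (simp add: infsum_norm col suminf_nonneg)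
  also have "\<dots> = (\<Sum>\<^sub>\<infinity>n. \<Sum>\<^sub>\<infinity>k. norm (g n k))"
    by (rule infsum_swap_banach[OF prod, symmetric])
  also have "\<dots> = (\<Sum>n. \<Sum>k. norm (g n k))"
    using rows by (simp add: infsum_norm row nonneg)
  finally show "(\<Sum>k. norm (\<Sum>n. g n k)) \<le> (\<Sum>n. \<Sum>k. norm (g n k))" .
  have "(\<Sum>n. \<Sum>k. g n k) = (\<Sum>\<^sub>\<infinity>n. \<Sum>\<^sub>\<infinity>k. g n k)"
    by (simp add: infsum_norm row row_norms)
  also have "\<dots> = (\<Sum>\<^sub>\<infinity>k. \<Sum>\<^sub>\<infinity>n. g n k)"
    by (rule infsum_swap_banach, rule abs_summable_summable)
      (use prod in \<open>simp add: case_prod_unfold\<close>)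
  also have "\<dots> = (\<Sum>k. \<Sum>n. g n k)"
    by (simp add: infsum_norm col sm)
  finally show "(\<lambda>k. \<Sum>n. g n k) sums (\<Sum>n. \<Sum>k. g n k)"
    using summable_sums[OF summable_norm_cancel[OF sm]] by simp
qed

section \<open>The Wiener algebra\<close>

lemma open_halfplane: "open (halfplane \<theta>)"
  unfolding halfplane_def by (rule open_halfspace_Re_gt)

lemma norm_nat_powr_le_1:
  assumes "s \<in> halfplane 0"
  shows "cmod (of_nat (Suc n) powr (- s)) \<le> 1"
proof -
  have "cmod (of_nat (Suc n) powr (- s)) = real (Suc n) powr (- Re s)"
    by (simp add: norm_powr_real_powr del: of_nat_Suc)
  also have "\<dots> \<le> real (Suc n) powr 0"
    using assms by (intro powr_mono) (auto simp: halfplane_def)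
  finally show ?thesis by simp
qed

lemma wiener_expansion_bound:
  assumes "wiener_expansion f a" "s \<in> halfplane 0"
  shows "cmod (f s) \<le> (\<Sum>n. cmod (a (Suc n)))"
proof -
  have "(\<lambda>n. a (Suc n) * of_nat (Suc n) powr (- s)) sums f s"
    using assms by (simp add: wiener_expansion_def dirichlet_sums_def)
  then have "f s = (\<Sum>n. a (Suc n) * of_nat (Suc n) powr (- s))"
    by (simp add: sums_iff)
  also have "cmod \<dots> \<le> (\<Sum>n. cmod (a (Suc n)))"
    by (rule norm_suminf_le)
      (use assms norm_nat_powr_le_1 in
        \<open>auto simp: wiener_expansion_def norm_mult intro!: mult_left_le simp del: of_nat_Suc\<close>)
  finally show ?thesis .
qed

lemma wiener_expansion_cong:
  assumes "\<And>s. s \<in> halfplane 0 \<Longrightarrow> f s = g s"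
  shows "wiener_expansion f a \<longleftrightarrow> wiener_expansion g a"
  using assms by (simp add: wiener_expansion_def)

text \<open>The terms are dominated by \<open>cmod (a (Suc n))\<close> on the entire half-plane, so
  the holomorphic partial sums converge uniformly there to \<open>f\<close>.\<close>

lemma wiener_expansion_analytic:
  assumes "wiener_expansion f a"
  shows "f analytic_on halfplane 0"
proof -
  let ?S = "\<lambda>N s. \<Sum>n<N. a (Suc n) * of_nat (Suc n) powr (- s)"
  have "uniform_limit (halfplane 0) ?S (\<lambda>s. \<Sum>n. a (Suc n) * of_nat (Suc n) powr (- s)) sequentially"
    by (rule Weierstrass_m_test[where M = "\<lambda>n. cmod (a (Suc n))"])
      (use assms norm_nat_powr_le_1 in
        \<open>auto simp: wiener_expansion_def norm_mult intro!: mult_left_le simp del: of_nat_Suc\<close>)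
  also have "?this \<longleftrightarrow> uniform_limit (halfplane 0) ?S f sequentially"
    using assms
    by (intro uniform_limit_cong) (auto simp: wiener_expansion_def dirichlet_sums_def sums_iff)
  finally have lim: "uniform_limit (halfplane 0) ?S f sequentially" .
  have "f holomorphic_on halfplane 0"
  proof (rule holomorphic_uniform_sequence[OF open_halfplane])
    show "?S N holomorphic_on halfplane 0" for N
      by (intro holomorphic_intros)
    fix s assume "s \<in> halfplane 0"
    then obtain d where "0 < d" "cball s d \<subseteq> halfplane 0"
      using open_halfplane open_contains_cball by blast
    then show "\<exists>d>0. cball s d \<subseteq> halfplane 0 \<and> uniform_limit (cball s d) ?S f sequentially"
      using uniform_limit_on_subset[OF lim] by blast
  qed
  then show ?thesis by (simp add: analytic_on_open open_halfplane)
qed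

lemma in_wiener_algebra_iff: "in_wiener_algebra f \<longleftrightarrow> (\<exists>a. wiener_expansion f a)"
  using wiener_expansion_analytic by (auto simp: in_wiener_algebra_def)

lemma norm_wiener_eq:
  assumes "wiener_expansion (eval f) a"
  shows "norm f = (\<Sum>n. cmod (a (Suc n)))"
proof -
  have "wiener_expansion (eval f) (a(0 := 0))"
    using assms by (simp add: wiener_expansion_def dirichlet_sums_def)
  then have "wiener_coeff f = a(0 := 0)"
    by (intro wiener_coeff_eqI) auto
  then show ?thesis by (simp add: norm_wiener_def)
qed

lemma norm_wiener_coeff_le: "cmod (wiener_coeff f (Suc n)) \<le> norm f"
  using sum_le_suminf[OF summable_wiener_coeff, of "{n}" f] by (simp add: norm_wiener_def)

text \<open>These functionals are the ones inserted into the supremum that defines absolutely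
  summing operators.\<close>

lemma wiener_coeff_in_dual_unit_ball: "(\<lambda>f. wiener_coeff f (Suc n)) \<in> dual_unit_ball"
proof -
  have bl: "bounded_linear (\<lambda>f. wiener_coeff f (Suc n))"
    by (rule bounded_linear_intro[where K = 1])
      (auto simp: wiener_coeff_add scaleR_scaleC wiener_coeff_scaleC norm_wiener_coeff_le scaleC_complex_def)
  moreover have "onorm (\<lambda>f. wiener_coeff f (Suc n)) \<le> 1"
    by (rule onorm_bound) (simp_all add: norm_wiener_coeff_le)
  ultimately show ?thesis
    by (simp add: dual_unit_ball_def bounded_clinear_def wiener_coeff_scaleC scaleC_complex_def)
qed

text \<open>Turns the limiting coefficient sequence of the compactness proof into an element of the
  algebra. \<open>a 0 = 0\<close> is the normalization built into
  \<open>wiener_coeff\<close>.\<close>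

lemma ex_wiener_with_coeff:
  assumes "summable (\<lambda>n. cmod (a (Suc n)))" "a 0 = 0"
  shows "\<exists>f. wiener_coeff f = a"
proof -
  define g where
    "g = (\<lambda>s. if s \<in> halfplane 0 then \<Sum>n. a (Suc n) * of_nat (Suc n) powr (- s) else 0)"
  have "summable (\<lambda>n. a (Suc n) * of_nat (Suc n) powr (- s))" if "s \<in> halfplane 0" for s
    by (rule summable_comparison_test'[OF assms(1)])
      (use norm_nat_powr_le_1[OF that] in \<open>auto simp: norm_mult intro!: mult_left_le simp del: of_nat_Suc\<close>)
  then have "wiener_expansion g a"
    using assms(1) by (auto simp: wiener_expansion_def dirichlet_sums_def g_def intro: summable_sums)
  moreover from this have "eval (Abs_wiener g) = g"
    by (intro Abs_wiener_inverse) (auto simp: in_wiener_algebra_iff, simp add: g_def)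
  ultimately show ?thesis
    using wiener_coeff_eqI assms(2) by metis
qed

lemma dual_unit_ball_bound:
  assumes "\<xi> \<in> dual_unit_ball"
  shows "cmod (\<xi> x) \<le> norm x"
proof -
  have "bounded_linear \<xi>" "onorm \<xi> \<le> 1"
    using assms by (auto simp: dual_unit_ball_def bounded_clinear_def)
  then have "norm (\<xi> x) \<le> onorm \<xi> * norm x" "onorm \<xi> * norm x \<le> 1 * norm x"
    using mult_right_mono[of "onorm \<xi>" 1 "norm x"] by (auto intro: onorm)
  then show ?thesis by simp
qed

section \<open>Composition operators with summable norms on the monomials\<close>

text \<open>The index \<open>n\<close> belongs to the monomial with base \<open>Suc n\<close>, and
  \<open>d n\<close> holds the Dirichlet coefficients of its image. The logarithm does not enter
  here; every operator property is drawn from \<open>summable_norms\<close>, which makes the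
  operator nuclear.\<close>

locale nuclear_symbol =
  fixes \<phi> :: "complex \<Rightarrow> complex" and d :: "nat \<Rightarrow> nat \<Rightarrow> complex"
  assumes maps: "s \<in> halfplane 0 \<Longrightarrow> \<phi> s \<in> halfplane 0"
    and expansion: "wiener_expansion (\<lambda>s. of_nat (Suc n) powr (- \<phi> s)) (d n)"
    and summable_norms: "summable (\<lambda>n. \<Sum>k. cmod (d n (Suc k)))"
begin

definition M :: "nat \<Rightarrow> real" where
  "M n = (\<Sum>k. cmod (d n (Suc k)))"

lemma summable_M: "summable M"
  using summable_norms by (simp add: M_def[abs_def])

lemma M_nonneg: "0 \<le> M n"
  using expansion by (auto simp: M_def wiener_expansion_def intro!: suminf_nonneg)

lemma summable_weighted:
  assumes "\<And>n. \<bar>c n\<bar> \<le> C"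
  shows "summable (\<lambda>n. c n * M n)"
proof (rule summable_comparison_test')
  show "summable (\<lambda>n. C * M n)" by (intro summable_mult summable_M)
  show "norm (c n * M n) \<le> C * M n" for n
    using assms M_nonneg by (simp add: abs_mult mult_right_mono)
qed

text \<open>Inserting the expansions of the images of the monomials gives a double series whose
  absolute sum is at most that of \<open>cmod (a (Suc n)) * M n\<close>, so it may be summed by
  columns, and the column sums are the coefficients \<open>b\<close>.\<close>

lemma composition_expansion:
  assumes f: "wiener_expansion f a"
  defines "b \<equiv> \<lambda>k. \<Sum>n. a (Suc n) * d n k"
  shows "wiener_expansion (f \<circ> \<phi>) b"
    and "(\<Sum>k. cmod (b (Suc k))) \<le> (\<Sum>n. cmod (a (Suc n)) * M n)"
proof -
  have sa: "summable (\<lambda>n. cmod (a (Suc n)))"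
    using f by (simp add: wiener_expansion_def)
  have sd: "summable (\<lambda>k. cmod (d n (Suc k)))" for n
    using expansion by (simp add: wiener_expansion_def)
  have row: "summable (\<lambda>k. norm (a (Suc n) * d n (Suc k)))" for n
    by (simp add: norm_mult summable_mult sd)
  have row_sum: "(\<Sum>k. norm (a (Suc n) * d n (Suc k))) = cmod (a (Suc n)) * M n" for n
    by (simp add: norm_mult suminf_mult sd M_def)
  have "cmod (a (Suc n)) \<le> (\<Sum>n. cmod (a (Suc n)))" for n
    using sum_le_suminf[OF sa, of "{n}"] by simp
  then have rows: "summable (\<lambda>n. \<Sum>k. norm (a (Suc n) * d n (Suc k)))"
    unfolding row_sum by (intro summable_weighted) auto
  note swap = double_series_swap[OF row rows]
  show "(\<Sum>k. cmod (b (Suc k))) \<le> (\<Sum>n. cmod (a (Suc n)) * M n)"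
    using swap(3) by (simp add: b_def row_sum)
  have "dirichlet_sums b s (f (\<phi> s))" if s: "s \<in> halfplane 0" for s
  proof -
    \<comment> \<open>The factors \<open>x k\<close> have modulus at most 1, so the majorants
      already found for the coefficients also justify the exchange at the point
      \<open>s\<close>.\<close>
    define x where "x k = (of_nat (Suc k) powr (- s) :: complex)" for k
    have x: "cmod (x k) \<le> 1" for k
      unfolding x_def by (rule norm_nat_powr_le_1[OF s])
    have le: "norm (a (Suc n) * d n (Suc k) * x k) \<le> norm (a (Suc n) * d n (Suc k))" for n k
      using x by (auto simp: norm_mult intro!: mult_left_le)
    have row': "summable (\<lambda>k. norm (a (Suc n) * d n (Suc k) * x k))" for n
      by (rule summable_comparison_test'[OF row]) (use le in auto)
    have rows': "summable (\<lambda>n. \<Sum>k. norm (a (Suc n) * d n (Suc k) * x k))"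
      by (rule summable_comparison_test'[OF rows])
        (simp only: real_norm_def, subst abs_of_nonneg, auto intro!: suminf_le suminf_nonneg row row' le)
    have "(\<lambda>k. d n (Suc k) * x k) sums (of_nat (Suc n) powr (- \<phi> s))" for n
      using expansion s by (simp add: wiener_expansion_def dirichlet_sums_def x_def)
    then have "(\<lambda>k. a (Suc n) * d n (Suc k) * x k) sums (a (Suc n) * of_nat (Suc n) powr (- \<phi> s))" for n
      by (metis (no_types, lifting) sums_mult mult.assoc sums_cong)
    then have inner: "(\<Sum>k. a (Suc n) * d n (Suc k) * x k) = a (Suc n) * of_nat (Suc n) powr (- \<phi> s)" for n
      by (simp add: sums_iff)
    have "(\<lambda>n. a (Suc n) * of_nat (Suc n) powr (- \<phi> s)) sums f (\<phi> s)"
      using f maps[OF s] by (simp add: wiener_expansion_def dirichlet_sums_def)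
    then have "(\<Sum>n. \<Sum>k. a (Suc n) * d n (Suc k) * x k) = f (\<phi> s)"
      unfolding inner by (simp add: sums_iff)
    moreover have "(\<Sum>n. a (Suc n) * d n (Suc k) * x k) = b (Suc k) * x k" for k
      unfolding b_def by (rule suminf_mult2[symmetric]) (rule summable_norm_cancel[OF swap(1)])
    ultimately show ?thesis
      using double_series_swap(4)[OF row' rows'] by (simp add: dirichlet_sums_def x_def)
  qed
  then show "wiener_expansion (f \<circ> \<phi>) b"
    using swap(2) by (simp add: wiener_expansion_def b_def)
qed

lemma in_wiener_algebra_compose: "\<forall>f. in_wiener_algebra f \<longrightarrow> in_wiener_algebra (f \<circ> \<phi>)"
  unfolding in_wiener_algebra_iff using composition_expansion(1) by blast

lemma eval_composition: "eval (composition_operator \<phi> f) s = (if s \<in> halfplane 0 then eval f (\<phi> s) else 0)"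
  by (cases "s \<in> halfplane 0")
    (simp_all add: eval_composition_operator[OF in_wiener_algebra_compose] eval_outside)

text \<open>The weighted sum is kept, rather than estimated by a multiple of \<open>norm f\<close>:
  absolute summability and compactness both need to see the individual coefficients.\<close>

lemma norm_composition_le:
  "norm (composition_operator \<phi> f) \<le> (\<Sum>n. cmod (wiener_coeff f (Suc n)) * M n)"
proof -
  note expansion = composition_expansion[OF wiener_coeff(2)[of f]]
  have "wiener_expansion (eval (composition_operator \<phi> f)) (\<lambda>k. \<Sum>n. wiener_coeff f (Suc n) * d n k)"
    by (rule wiener_expansion_cong[THEN iffD2, OF _ expansion(1)]) (simp add: eval_composition)
  then show ?thesis
    using expansion(2) by (simp only: norm_wiener_eq)
qed

lemma composition_add:
  "composition_operator \<phi> (f + g) = composition_operator \<phi> f + composition_operator \<phi> g"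
  by (rule wiener_eqI) (simp add: eval_composition)

lemma composition_scaleC: "composition_operator \<phi> (c *\<^sub>C f) = c *\<^sub>C composition_operator \<phi> f"
  by (rule wiener_eqI) (simp add: eval_composition)

lemma composition_diff:
  "composition_operator \<phi> (f - g) = composition_operator \<phi> f - composition_operator \<phi> g"
  by (rule wiener_eqI) (simp add: eval_composition)

lemma summable_coeff_M: "summable (\<lambda>n. cmod (wiener_coeff f (Suc n)) * M n)"
  by (rule summable_weighted[where C = "norm f"]) (simp add: norm_wiener_coeff_le)

lemma bounded_clinear_composition: "bounded_clinear (composition_operator \<phi>)"
  unfolding bounded_clinear_def
proof (intro conjI allI bounded_linear_intro[where K = "suminf M"])
  fix f
  have "norm (composition_operator \<phi> f) \<le> (\<Sum>n. cmod (wiener_coeff f (Suc n)) * M n)"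
    by (rule norm_composition_le)
  also have "\<dots> \<le> (\<Sum>n. norm f * M n)"
    by (intro suminf_le mult_right_mono norm_wiener_coeff_le M_nonneg summable_coeff_M
        summable_mult summable_M)
  finally show "norm (composition_operator \<phi> f) \<le> norm f * suminf M"
    by (simp add: suminf_mult summable_M)
  show "composition_operator \<phi> (r *\<^sub>R f) = r *\<^sub>R composition_operator \<phi> f" for r
    unfolding scaleR_scaleC by (rule composition_scaleC)
qed (rule composition_add composition_scaleC)+

lemma induces_bounded: "induces_bounded_composition_operator \<phi>"
  using in_wiener_algebra_compose bounded_clinear_composition
  by (simp add: induces_bounded_composition_operator_def)

text \<open>After exchanging the finite sum over the \<open>x k\<close> with the series over
  \<open>n\<close>, each inner sum involves a single coefficient functional of the dual unit ball
  and is at most the supremum; the weights \<open>M n\<close> then sum up to the constant.\<close>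

lemma absolutely_summing: "absolutely_summing (composition_operator \<phi>)"
  unfolding absolutely_summing_def
proof (intro conjI bounded_clinear_composition exI allI impI)
  \<comment> \<open>The summand 1 only makes the constant strictly positive.\<close>
  show "0 < suminf M + 1"
    using suminf_nonneg[OF summable_M M_nonneg] by linarith
  fix N :: nat and x :: "nat \<Rightarrow> wiener"
  define S where "S = (SUP \<xi>\<in>dual_unit_ball. \<Sum>k=1..N. cmod (\<xi> (x k)))"
  have bdd: "bdd_above ((\<lambda>\<xi>. \<Sum>k=1..N. cmod (\<xi> (x k))) ` dual_unit_ball)"
    by (rule bdd_aboveI2[where M = "\<Sum>k=1..N. norm (x k)"])
      (intro sum_mono dual_unit_ball_bound)
  have coeff_le: "(\<Sum>k=1..N. cmod (wiener_coeff (x k) (Suc n))) \<le> S" for n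
    unfolding S_def by (rule cSUP_upper2[OF bdd wiener_coeff_in_dual_unit_ball[of n]]) simp
  have S: "0 \<le> S"
    by (rule order_trans[OF sum_nonneg coeff_le]) simp
  have "(\<Sum>k=1..N. norm (composition_operator \<phi> (x k)))
      \<le> (\<Sum>k=1..N. \<Sum>n. cmod (wiener_coeff (x k) (Suc n)) * M n)"
    by (intro sum_mono norm_composition_le)
  also have "\<dots> = (\<Sum>n. (\<Sum>k=1..N. cmod (wiener_coeff (x k) (Suc n))) * M n)"
    by (simp add: suminf_sum summable_coeff_M sum_distrib_right)
  also have "\<dots> \<le> (\<Sum>n. S * M n)"
    by (intro suminf_le mult_right_mono coeff_le M_nonneg summable_mult summable_M)
      (simp add: sum_distrib_right summable_sum summable_coeff_M)
  also have "\<dots> \<le> (suminf M + 1) * S"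
    using S by (simp add: suminf_mult summable_M algebra_simps)
  finally show "(\<Sum>k=1..N. norm (composition_operator \<phi> (x k)))
      \<le> (suminf M + 1) * (SUP \<xi>\<in>dual_unit_ball. \<Sum>k=1..N. cmod (\<xi> (x k)))"
    unfolding S_def .
qed

text \<open>
  Coefficientwise convergence in the unit ball becomes norm convergence under the operator, by
  dominated convergence, and the ball is sequentially compact for coefficientwise convergence.
\<close>

lemma compact_image: "compact (composition_operator \<phi> ` cball 0 1)"
  unfolding compact_eq_seq_compact_metric seq_compact_def
proof (intro allI impI)
  fix y :: "nat \<Rightarrow> wiener"
  assume "\<forall>n. y n \<in> composition_operator \<phi> ` cball 0 1"
  then have "\<forall>n. \<exists>f. norm f \<le> 1 \<and> y n = composition_operator \<phi> f"
    by (fastforce simp: image_iff)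
  then obtain f where f: "\<And>n. norm (f n) \<le> 1" and y: "\<And>n. y n = composition_operator \<phi> (f n)"
    by metis
  have coeff: "cmod (wiener_coeff (f j) n) \<le> 1" for j n
    using norm_wiener_coeff_le[of "f j" "n - 1"] f[of j] wiener_coeff(1)[of "f j"]
    by (cases n) auto
  \<comment> \<open>Tychonoff for a countable product of discs; the product is metrizable, so this
    yields convergent subsequences and replaces a diagonal argument.\<close>
  have "compact (PiE UNIV (\<lambda>_::nat. cball (0::complex) 1))"
    using compactin_PiE[of "\<lambda>_. euclidean" UNIV "\<lambda>_::nat. cball (0::complex) 1"]
    by (simp add: euclidean_product_topology)
  then have "seq_compact (PiE UNIV (\<lambda>_::nat. cball (0::complex) 1))"
    by (simp add: compact_eq_seq_compact_metric)
  moreover have "\<forall>j. wiener_coeff (f j) \<in> PiE UNIV (\<lambda>_. cball 0 1)"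
    using coeff by auto
  ultimately obtain \<alpha> r where r: "strict_mono r"
    and lim: "((\<lambda>j. wiener_coeff (f j)) \<circ> r) \<longlonglongrightarrow> \<alpha>"
    unfolding seq_compact_def by metis
  have lim': "(\<lambda>j. wiener_coeff (f (r j)) n) \<longlonglongrightarrow> \<alpha> n" for n
  proof -
    have "isCont (\<lambda>a::nat \<Rightarrow> complex. a n) \<alpha>"
      by (metis continuous_on_product_coordinates continuous_on_eq_continuous_at open_UNIV UNIV_I)
    then show ?thesis
      using lim by (auto simp: o_def dest!: isCont_tendsto_compose)
  qed
  \<comment> \<open>A Fatou argument: finite sections pass to the limit, so coefficientwise
    convergence already keeps the limit in the closed unit ball.\<close>
  have partial: "(\<Sum>n<N. cmod (\<alpha> (Suc n))) \<le> 1" for N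
  proof (rule tendsto_upperbound)
    show "(\<lambda>j. \<Sum>n<N. cmod (wiener_coeff (f (r j)) (Suc n))) \<longlonglongrightarrow> (\<Sum>n<N. cmod (\<alpha> (Suc n)))"
      by (intro tendsto_intros lim')
    have "(\<Sum>n<N. cmod (wiener_coeff (f j) (Suc n))) \<le> 1" for j
      using sum_le_suminf[OF summable_wiener_coeff, of "{..<N}" "f j"] f[of j]
      by (simp add: norm_wiener_def)
    then show "\<forall>\<^sub>F j in sequentially. (\<Sum>n<N. cmod (wiener_coeff (f (r j)) (Suc n))) \<le> 1"
      by simp
  qed simp
  have "summable (\<lambda>n. cmod (\<alpha> (Suc n)))"
    by (rule summableI_nonneg_bounded[OF _ partial]) simp
  moreover have "\<alpha> 0 = 0"
    using lim'[of 0] by (simp add: wiener_coeff LIMSEQ_const_iff)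
  ultimately obtain g where g: "wiener_coeff g = \<alpha>"
    using ex_wiener_with_coeff by blast
  have "norm g \<le> 1"
    unfolding norm_wiener_def g
    by (rule suminf_le_const[OF \<open>summable (\<lambda>n. cmod (\<alpha> (Suc n)))\<close> partial])
  \<comment> \<open>The preimages need not converge to \<open>g\<close> in norm; the summable
    weights \<open>M n\<close> supply the missing control. The majorant \<open>2 * M n\<close> comes
    from the distance of two points of the unit ball.\<close>
  have "(\<lambda>j. \<Sum>n. cmod (wiener_coeff (f (r j) - g) (Suc n)) * M n) \<longlonglongrightarrow> (\<Sum>n. 0)"
  proof (rule tannerys_theorem[where M = "\<lambda>n. 2 * M n", THEN conjunct2, THEN conjunct2])
    have diff: "wiener_coeff (f' - g) n = wiener_coeff f' n - \<alpha> n" for f' n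
    proof -
      have "f' - g = f' + (- 1) *\<^sub>C g" by (rule wiener_eqI) simp
      then show ?thesis by (simp only: wiener_coeff_add wiener_coeff_scaleC g) simp
    qed
    show "(\<lambda>j. cmod (wiener_coeff (f (r j) - g) (Suc n)) * M n) \<longlonglongrightarrow> 0" for n
      unfolding diff using tendsto_mult_right[OF tendsto_norm[OF LIM_zero[OF lim'[of "Suc n"]]], of "M n"]
      by simp
    have "norm (f (r j) - g) \<le> 2" for j
      using norm_triangle_ineq4[of "f (r j)" g] f[of "r j"] \<open>norm g \<le> 1\<close> by simp
    then have "cmod (wiener_coeff (f (r j) - g) (Suc n)) \<le> 2" for j n
      by (rule order_trans[OF norm_wiener_coeff_le])
    then show "\<forall>\<^sub>F (n, j) in sequentially \<times>\<^sub>F sequentially.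
        norm (cmod (wiener_coeff (f (r j) - g) (Suc n)) * M n) \<le> 2 * M n"
      by (intro always_eventually) (auto simp: M_nonneg mult_right_mono)
    show "summable (\<lambda>n. 2 * M n)" by (intro summable_mult summable_M)
  qed simp
  then have "(\<lambda>j. norm (composition_operator \<phi> (f (r j)) - composition_operator \<phi> g)) \<longlonglongrightarrow> 0"
    unfolding composition_diff[symmetric] suminf_zero
    by (rule Lim_null_comparison[rotated]) (simp add: norm_composition_le)
  then have "(y \<circ> r) \<longlonglongrightarrow> composition_operator \<phi> g"
    unfolding tendsto_norm_zero_iff LIM_zero_iff by (simp add: o_def y)
  then show "\<exists>l\<in>composition_operator \<phi> ` cball 0 1. \<exists>r. strict_mono r \<and> (y \<circ> r) \<longlonglongrightarrow> l"
    using r \<open>norm g \<le> 1\<close> by auto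
qed

lemma compact_composition: "compact_operator (composition_operator \<phi>)"
  using bounded_clinear_composition compact_image
  by (simp add: compact_operator_def closure_closed compact_imp_closed)

end

section \<open>Absolute sums of binomial series\<close>

lemma pochhammer_real_nonneg: "0 \<le> x \<Longrightarrow> 0 \<le> pochhammer (x::real) n"
  by (auto simp: pochhammer_prod intro!: prod_nonneg)

text \<open>With the sign absorbed, the numerator is the rising product of \<open>- a\<close>,
  \<open>1 - a\<close>, \<open>2 - a\<close> and so on, in which only the first factor is
  nonpositive.\<close>

lemma gbinomial_alternating_nonpos:
  fixes a :: real
  assumes "0 \<le> a" "a \<le> 1"
  shows "(a gchoose Suc k) * (- 1) ^ Suc k \<le> 0"
proof -
  have "(a gchoose Suc k) * (- 1) ^ Suc k = pochhammer (- a) (Suc k) / fact (Suc k)"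
    by (subst gbinomial_pochhammer) (simp flip: power_mult_distrib)
  also have "pochhammer (- a) (Suc k) = - a * pochhammer (1 - a) k"
    by (simp add: pochhammer_rec)
  also have "- a * pochhammer (1 - a) k / fact (Suc k) \<le> 0"
    using assms by (intro divide_nonpos_pos mult_nonpos_nonneg pochhammer_real_nonneg) auto
  finally show ?thesis .
qed

text \<open>
  For \<open>0 \<le> a \<le> 1\<close> all terms but the first of the series of \<open>(1 - z) powr a\<close> are nonpositive, so the
  partial sums of the absolute values are governed by the partial sums at \<open>z = 1\<close>.
\<close>

lemma sum_abs_gbinomial_le_2:
  fixes a :: real
  assumes "0 \<le> a" "a \<le> 1"
  shows "(\<Sum>k\<le>n. \<bar>a gchoose k\<bar>) \<le> 2"
proof -
  have abs: "\<bar>a gchoose Suc k\<bar> = - ((a gchoose Suc k) * (- 1) ^ Suc k)" for k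
    using abs_of_nonpos[OF gbinomial_alternating_nonpos[OF assms, of k]]
    by (simp add: abs_mult power_abs del: power_Suc)
  have "(\<Sum>k\<le>n. \<bar>a gchoose k\<bar>) \<le> (\<Sum>k\<le>Suc n. \<bar>a gchoose k\<bar>)"
    by simp
  also have "\<dots> = 1 - (\<Sum>k\<le>n. (a gchoose Suc k) * (- 1) ^ Suc k)"
    by (subst sum.atMost_Suc_shift) (simp add: abs sum_negf)
  also have "\<dots> = 2 - (\<Sum>k\<le>Suc n. (a gchoose k) * (- 1) ^ k)"
    by (subst sum.atMost_Suc_shift) simp
  \<comment> \<open>The alternating partial sum collapses to one signed binomial coefficient of
    \<open>a - 1\<close>, a rising factorial of \<open>1 - a \<ge> 0\<close> over a
    factorial.\<close>
  also have "(\<Sum>k\<le>Suc n. (a gchoose k) * (- 1) ^ k) = pochhammer (1 - a) (Suc n) / fact (Suc n)"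
    by (subst gbinomial_sum_lower_neg, subst gbinomial_pochhammer) (simp flip: power_mult_distrib)
  also have "2 - \<dots> \<le> 2"
    using assms divide_nonneg_pos[OF pochhammer_real_nonneg, of "1 - a" "fact (Suc n)" "Suc n"] by simp
  finally show ?thesis .
qed

text \<open>By Pascal's rule, raising the exponent by 1 at most doubles the absolute sum; in terms
  of functions, it multiplies by \<open>1 - z\<close>, whose coefficients have absolute sum 2.
  Partial sums are bounded uniformly in \<open>n\<close>, so that summability can be
  deduced.\<close>

lemma sum_abs_gbinomial_le:
  fixes a :: real
  assumes "0 \<le> a" "a \<le> real m + 1"
  shows "(\<Sum>k\<le>n. \<bar>a gchoose k\<bar>) \<le> 2 ^ Suc m"
  using assms
proof (induction m arbitrary: a n)
  case 0
  then show ?case using sum_abs_gbinomial_le_2 by simp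
next
  case (Suc m)
  show ?case
  proof (cases "a \<le> 1")
    case True
    have "(\<Sum>k\<le>n. \<bar>a gchoose k\<bar>) \<le> 2 ^ 1"
      using sum_abs_gbinomial_le_2 Suc.prems True by simp
    also have "\<dots> \<le> 2 ^ Suc (Suc m)"
      by (intro power_increasing) auto
    finally show ?thesis .
  next
    case False
    have IH: "(\<Sum>k\<le>n. \<bar>(a - 1) gchoose k\<bar>) \<le> 2 ^ Suc m" for n
      using Suc.IH[of "a - 1"] Suc.prems False by simp
    have "(\<Sum>k\<le>n. \<bar>a gchoose k\<bar>) \<le> (\<Sum>k\<le>Suc n. \<bar>a gchoose k\<bar>)"
      by simp
    also have "\<dots> = 1 + (\<Sum>k\<le>n. \<bar>((a - 1) gchoose k) + ((a - 1) gchoose Suc k)\<bar>)"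
      using gbinomial_Suc_Suc[of "a - 1"] by (subst sum.atMost_Suc_shift) simp
    also have "\<dots> \<le> 1 + (\<Sum>k\<le>n. \<bar>(a - 1) gchoose k\<bar> + \<bar>(a - 1) gchoose Suc k\<bar>)"
      by (intro add_left_mono sum_mono abs_triangle_ineq)
    also have "\<dots> = (\<Sum>k\<le>n. \<bar>(a - 1) gchoose k\<bar>) + (\<Sum>k\<le>Suc n. \<bar>(a - 1) gchoose k\<bar>)"
      using sum.atMost_Suc_shift[of "\<lambda>k. \<bar>(a - 1) gchoose k\<bar>" n]
      by (simp add: sum.distrib del: sum.atMost_Suc)
    also have "\<dots> \<le> 2 ^ Suc m + 2 ^ Suc m"
      by (intro add_mono IH)
    finally show ?thesis by simp
  qed
qed

lemma
  fixes a :: real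
  assumes "0 \<le> a"
  shows summable_abs_gbinomial: "summable (\<lambda>k. \<bar>a gchoose k\<bar>)"
    and suminf_abs_gbinomial_le: "(\<Sum>k. \<bar>a gchoose k\<bar>) \<le> 2 * 2 powr a"
proof -
  define m where "m = nat \<lfloor>a\<rfloor>"
  have m: "real m \<le> a" "a \<le> real m + 1"
    using assms unfolding m_def by linarith+
  have partial: "(\<Sum>k<n. \<bar>a gchoose k\<bar>) \<le> 2 ^ Suc m" for n
    using sum_abs_gbinomial_le[OF assms m(2), of n]
    by (rule order_trans[rotated]) (auto intro: sum_mono2)
  show summable: "summable (\<lambda>k. \<bar>a gchoose k\<bar>)"
    by (rule summableI_nonneg_bounded[OF _ partial]) simp
  have "(\<Sum>k. \<bar>a gchoose k\<bar>) \<le> 2 ^ Suc m"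
    by (rule suminf_le_const[OF summable partial])
  also have "\<dots> = 2 * 2 powr real m"
    by (simp add: powr_realpow)
  also have "\<dots> \<le> 2 * 2 powr a"
    using m by simp
  finally show "(\<Sum>k. \<bar>a gchoose k\<bar>) \<le> 2 * 2 powr a" .
qed

section \<open>The symbol\<close>

text \<open>Turns a power series in \<open>2 powr (- s)\<close> into a Dirichlet series supported on
  the powers of 2; on these, \<open>multiplicity 2\<close> recovers the exponent.\<close>

definition lacunary :: "(nat \<Rightarrow> complex) \<Rightarrow> nat \<Rightarrow> complex" where
  "lacunary b n = (if n \<in> range (\<lambda>k. 2 ^ k) then b (multiplicity 2 n) else 0)"

lemma lacunary_power [simp]: "lacunary b (2 ^ k) = b k"
  by (simp add: lacunary_def)

text \<open>The shift by 1 is due to \<open>dirichlet_sums\<close>, where the term of index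
  \<open>n\<close> belongs to the integer \<open>Suc n\<close>.\<close>

lemma strict_mono_pow2_pred: "strict_mono (\<lambda>k. 2 ^ k - 1 :: nat)"
proof (rule strict_monoI)
  fix m n :: nat assume "m < n"
  then have "(2::nat) ^ m < 2 ^ n" by simp
  then show "(2::nat) ^ m - 1 < 2 ^ n - 1" by (simp add: diff_less_mono)
qed

lemma lacunary_Suc_eq_0:
  assumes "n \<notin> range (\<lambda>k. 2 ^ k - 1)"
  shows "lacunary b (Suc n) = 0"
proof -
  have "Suc n \<noteq> 2 ^ k" for k
    using assms by (metis diff_Suc_1 rangeI)
  then show ?thesis by (auto simp: lacunary_def)
qed

lemma dirichlet_sums_lacunary:
  "dirichlet_sums (lacunary b) s v \<longleftrightarrow> (\<lambda>k. b k * (2 powr (- s)) ^ k) sums v"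
proof -
  have pow: "(of_nat (2 ^ k) :: complex) powr (- s) = (2 powr (- s)) ^ k" for k
  proof (induction k)
    case (Suc k)
    have "(of_nat (2 ^ Suc k) :: complex) powr (- s) = (of_nat 2 * of_nat (2 ^ k)) powr (- s)"
      by simp
    also have "\<dots> = of_nat 2 powr (- s) * of_nat (2 ^ k) powr (- s)"
      by (rule powr_times_real) (auto simp del: of_nat_power)
    finally show ?case using Suc by simp
  qed simp
  show ?thesis
    unfolding dirichlet_sums_def
    by (subst sums_mono_reindex[OF strict_mono_pow2_pred, symmetric])
      (simp_all add: lacunary_Suc_eq_0 pow del: of_nat_Suc of_nat_power)
qed

lemma summable_lacunary: "summable (\<lambda>n. cmod (lacunary b (Suc n))) \<longleftrightarrow> summable (\<lambda>k. cmod (b k))"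
  by (subst summable_mono_reindex[OF strict_mono_pow2_pred, symmetric])
    (simp_all add: lacunary_Suc_eq_0)

lemma suminf_lacunary: "(\<Sum>n. cmod (lacunary b (Suc n))) = (\<Sum>k. cmod (b k))"
  by (subst suminf_mono_reindex[OF strict_mono_pow2_pred, symmetric])
    (simp_all add: lacunary_Suc_eq_0)

text \<open>The symbol in the variable \<open>w = 2 powr (- s)\<close>. Its values on the unit
  circle later give the function on the torus.\<close>

definition symbol_disc :: "complex \<Rightarrow> complex" where
  "symbol_disc w = 3 - Ln (1 - w)"

definition symbol_disc_coeff :: "nat \<Rightarrow> complex" where
  "symbol_disc_coeff k = (if k = 0 then 3 else 1 / of_nat k)"

definition symbol :: "complex \<Rightarrow> complex" where
  "symbol s = symbol_disc (2 powr (- s))"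

lemma symbol_disc_sums:
  assumes "cmod w < 1"
  shows "(\<lambda>k. symbol_disc_coeff k * w ^ k) sums symbol_disc w"
proof -
  have "(\<lambda>k. (if k = 0 then 3 else 0) - (- (w ^ k) / of_nat k)) sums (3 - Ln (1 - w))"
    using Ln_series'[of "- w"] assms
    by (intro sums_diff) (use sums_single[of 0 "\<lambda>_. 3::complex"] in auto)
  also have "(\<lambda>k. (if k = 0 then 3 else 0) - (- (w ^ k) / of_nat k)) = (\<lambda>k. symbol_disc_coeff k * w ^ k)"
    by (auto simp: symbol_disc_coeff_def)
  finally show ?thesis by (simp add: symbol_disc_def)
qed

lemma cmod_2_powr_less_1: "s \<in> halfplane 0 \<Longrightarrow> cmod (2 powr (- s)) < 1"
  using powr_less_mono[of "- Re s" 0 "2::real"] by (simp add: norm_powr_real_powr halfplane_def)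

lemma symbol_expansion: "s \<in> halfplane 0 \<Longrightarrow> dirichlet_sums (lacunary symbol_disc_coeff) s (symbol s)"
  by (simp add: dirichlet_sums_lacunary symbol_def symbol_disc_sums cmod_2_powr_less_1)

lemma Re_symbol_disc: "w \<noteq> 1 \<Longrightarrow> Re (symbol_disc w) = 3 - ln (cmod (1 - w))"
  by (simp add: symbol_disc_def)

text \<open>Only an upper bound for \<open>cmod (1 - w)\<close> is required, since the singularity
  pushes the values to the right.\<close>

lemma symbol_maps:
  assumes "s \<in> halfplane 0"
  shows "symbol s \<in> halfplane 0"
proof -
  let ?w = "2 powr (- s)"
  have w: "cmod ?w < 1" by (rule cmod_2_powr_less_1[OF assms])
  then have "?w \<noteq> 1" by auto
  have "cmod (1 - ?w) \<le> 2"
    using norm_triangle_ineq4[of 1 ?w] w by simp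
  then have "ln (cmod (1 - ?w)) \<le> 2 - 1"
    using ln_le_minus_one[of "cmod (1 - ?w)"] \<open>?w \<noteq> 1\<close> by simp
  then show ?thesis
    using \<open>?w \<noteq> 1\<close> by (simp add: symbol_def halfplane_def Re_symbol_disc)
qed

lemma symbol_analytic: "symbol analytic_on halfplane 0"
proof -
  have "1 - 2 powr (- s) \<notin> \<real>\<^sub>\<le>\<^sub>0" if "s \<in> halfplane 0" for s
  proof -
    have "Re (2 powr (- s)) < 1"
      using cmod_2_powr_less_1[OF that] complex_Re_le_cmod[of "2 powr (- s)"] by linarith
    then show ?thesis by (auto simp: complex_nonpos_Reals_iff)
  qed
  then have "symbol holomorphic_on halfplane 0"
    unfolding symbol_def[abs_def] symbol_disc_def by (intro holomorphic_intros) auto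
  then show ?thesis by (simp add: analytic_on_open open_halfplane)
qed

lemma symbol_dirichlet_expansion: "dirichlet_expansion symbol (lacunary symbol_disc_coeff)"
  unfolding dirichlet_expansion_def using symbol_expansion by blast

lemma symbol_convergent: "convergent_dirichlet_series symbol"
  unfolding convergent_dirichlet_series_def
  using symbol_analytic symbol_dirichlet_expansion by blast

text \<open>Elements of the algebra are bounded, so blow-up along the positive real axis suffices
  and no comparison of coefficients with the harmonic series is made.\<close>

lemma symbol_not_in_wiener_algebra: "\<not> in_wiener_algebra symbol"
proof
  assume "in_wiener_algebra symbol"
  then obtain a where "wiener_expansion symbol a"
    by (auto simp: in_wiener_algebra_def)
  then obtain C where C: "\<And>s. s \<in> halfplane 0 \<Longrightarrow> cmod (symbol s) \<le> C"
    using wiener_expansion_bound by blast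
  \<comment> \<open>Chosen so that \<open>3 - ln x = 4 + \<bar>C\<bar>\<close> exceeds
    \<open>C\<close>; the point \<open>s\<close> below solves
    \<open>2 powr (- s) = 1 - x\<close>.\<close>
  define x where "x = exp (- \<bar>C\<bar> - 1)"
  have x: "0 < x" "x < 1" by (auto simp: x_def)
  define s where "s = complex_of_real (- log 2 (1 - x))"
  have "s \<in> halfplane 0"
    using x by (simp add: s_def halfplane_def)
  have "2 powr (- s) = complex_of_real (2 powr log 2 (1 - x))"
    unfolding s_def by (subst powr_of_real[symmetric]) auto
  also have "\<dots> = complex_of_real (1 - x)"
    using x by (subst powr_log_cancel) auto
  finally have "symbol s = symbol_disc (1 - complex_of_real x)"
    by (simp add: symbol_def)
  then have "Re (symbol s) = 3 - ln x"
    using x by (simp add: Re_symbol_disc)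
  also have "\<dots> = 4 + \<bar>C\<bar>" by (simp add: x_def)
  finally have "4 + \<bar>C\<bar> \<le> C"
    using C[OF \<open>s \<in> halfplane 0\<close>] complex_Re_le_cmod[of "symbol s"] by linarith
  then show False by linarith
qed

text \<open>Taylor coefficients of \<open>exp (- 3 * l) * (1 - w) powr l\<close> with
  \<open>l = ln (Suc n)\<close>; the exponential equals \<open>Suc n powr (- 3)\<close>.\<close>

definition symbol_powr_coeff :: "nat \<Rightarrow> nat \<Rightarrow> complex" where
  "symbol_powr_coeff n k =
     exp (- 3 * of_real (ln (real (Suc n)))) * (of_real (ln (real (Suc n))) gchoose k) * (- 1) ^ k"

lemma cmod_symbol_powr_coeff:
  "cmod (symbol_powr_coeff n k) = real (Suc n) powr (- 3) * \<bar>ln (real (Suc n)) gchoose k\<bar>"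
proof -
  have "(of_real (ln (real (Suc n))) gchoose k :: complex) = of_real (ln (real (Suc n)) gchoose k)"
    by (simp add: gbinomial_prod_rev)
  then show ?thesis
    by (simp add: symbol_powr_coeff_def norm_mult norm_power powr_def del: of_nat_Suc)
qed

lemma symbol_powr_expansion:
  assumes "s \<in> halfplane 0"
  shows "dirichlet_sums (lacunary (symbol_powr_coeff n)) s (of_nat (Suc n) powr (- symbol s))"
proof -
  define l where "l = ln (real (Suc n))"
  define w where "w = (2::complex) powr (- s)"
  have w: "cmod w < 1" unfolding w_def by (rule cmod_2_powr_less_1[OF assms])
  have "Ln (of_nat (Suc n)) = complex_of_real l"
    using Ln_of_real[of "real (Suc n)"] by (simp add: l_def)
  then have "of_nat (Suc n) powr (- symbol s) = exp (- symbol s * of_real l)"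
    by (simp add: powr_def del: of_nat_Suc)
  also have "- symbol s * of_real l = - 3 * of_real l + of_real l * Ln (1 - w)"
    by (simp add: symbol_def symbol_disc_def w_def algebra_simps)
  \<comment> \<open>The symbol and \<open>powr\<close> use the same principal logarithm of
    \<open>1 - w\<close>, so no branch correction arises.\<close>
  also have "exp \<dots> = exp (- 3 * of_real l) * (1 - w) powr (of_real l)"
    unfolding exp_add using w by (auto simp: powr_def)
  finally have eq: "of_nat (Suc n) powr (- symbol s) = exp (- 3 * of_real l) * (1 + - w) powr (of_real l)"
    by simp
  have "(\<lambda>k. exp (- 3 * of_real l) * ((of_real l gchoose k) * (- w) ^ k)) sums
      (exp (- 3 * of_real l) * (1 + - w) powr (of_real l))"
    by (intro sums_mult gen_binomial_complex) (simp add: w)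
  then show ?thesis
    unfolding dirichlet_sums_lacunary eq symbol_powr_coeff_def l_def[symmetric] w_def[symmetric]
    by (simp add: power_minus[of w] mult_ac)
qed

interpretation symbol: nuclear_symbol symbol "\<lambda>n. lacunary (symbol_powr_coeff n)"
proof
  have ln_nonneg: "0 \<le> ln (real (Suc n))" for n by simp
  have summable: "summable (\<lambda>k. cmod (symbol_powr_coeff n k))" for n
    unfolding cmod_symbol_powr_coeff by (intro summable_mult summable_abs_gbinomial ln_nonneg)
  show "wiener_expansion (\<lambda>s. of_nat (Suc n) powr (- symbol s)) (lacunary (symbol_powr_coeff n))" for n
    by (simp add: wiener_expansion_def summable_lacunary summable symbol_powr_expansion del: of_nat_Suc)
  show "summable (\<lambda>n. \<Sum>k. cmod (lacunary (symbol_powr_coeff n) (Suc k)))"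
  proof (rule summable_comparison_test')
    have "summable (\<lambda>n. real n powr (- 2))" by (simp add: summable_real_powr_iff)
    then show "summable (\<lambda>n. 2 * real (Suc n) powr (- 2))"
      by (intro summable_mult) (subst summable_Suc_iff)
    fix n
    have "(\<Sum>k. cmod (lacunary (symbol_powr_coeff n) (Suc k)))
        = real (Suc n) powr (- 3) * (\<Sum>k. \<bar>ln (real (Suc n)) gchoose k\<bar>)"
      unfolding suminf_lacunary cmod_symbol_powr_coeff
      by (intro suminf_mult summable_abs_gbinomial ln_nonneg)
    also have "\<dots> \<le> real (Suc n) powr (- 3) * (2 * 2 powr ln (real (Suc n)))"
      by (intro mult_left_mono suminf_abs_gbinomial_le ln_nonneg) simp
    \<comment> \<open>Rewriting the binomial bound as a power of \<open>Suc n\<close> shows, by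
      \<open>ln 2 \<le> 1\<close>, that it grows at most linearly.\<close>
    also have "2 powr ln (real (Suc n)) = real (Suc n) powr ln 2"
      by (simp add: powr_def mult.commute)
    also have "real (Suc n) powr ln 2 \<le> real (Suc n) powr 1"
      using ln_le_minus_one[of "2::real"] by (intro powr_mono) auto
    also have "real (Suc n) powr (- 3) * (2 * real (Suc n) powr 1) = 2 * real (Suc n) powr (- 2)"
      using powr_add[of "real (Suc n)" "- 3" 1] by simp
    finally have "(\<Sum>k. cmod (lacunary (symbol_powr_coeff n) (Suc k))) \<le> 2 * real (Suc n) powr (- 2)"
      by simp
    moreover have "0 \<le> (\<Sum>k. cmod (lacunary (symbol_powr_coeff n) (Suc k)))"
      unfolding suminf_lacunary by (intro suminf_nonneg summable) simp
    ultimately show "norm (\<Sum>k. cmod (lacunary (symbol_powr_coeff n) (Suc k))) \<le> 2 * real (Suc n) powr (- 2)"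
      by simp
  qed
qed (rule symbol_maps)

section \<open>Fourier coefficients on the circle\<close>

lemma measurable_circle_parametrization:
  "(\<lambda>t. cis (2 * pi * t)) \<in> measurable (uniform_measure lborel {0..1}) (restrict_space borel (sphere 0 1))"
proof -
  have "continuous_on UNIV (\<lambda>t. cis (2 * pi * t))"
    unfolding cis_conv_exp by (intro continuous_intros)
  then show ?thesis
    by (intro measurable_restrict_space2)
      (auto intro!: borel_measurable_continuous_onI simp: measurable_cong_sets[OF sets_uniform_measure refl])
qed

lemma space_circle_measure: "space circle_measure = sphere 0 1"
  by (simp add: circle_measure_def space_restrict_space)

lemma measurable_circle_measure: "f \<in> measurable borel N \<Longrightarrow> f \<in> measurable circle_measure N"
  by (simp add: circle_measure_def measurable_restrict_space1)

lemma uniform_unit_interval: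
  "uniform_measure lborel {0..1::real} = density lborel (\<lambda>t. ennreal (indicator {0..1} t))"
  unfolding uniform_measure_def by (rule density_cong) (auto split: split_indicator)

lemma
  fixes f :: "complex \<Rightarrow> 'a::{banach, second_countable_topology}"
  assumes f: "f \<in> borel_measurable borel"
  shows integrable_circle_measure:
      "integrable circle_measure f \<longleftrightarrow> set_integrable lborel {0..1} (\<lambda>t. f (cis (2 * pi * t)))"
    and integral_circle_measure:
      "integral\<^sup>L circle_measure f = (LINT t:{0..1}|lborel. f (cis (2 * pi * t)))"
proof -
  have f': "f \<in> borel_measurable (restrict_space borel (sphere 0 1))"
    using f by (rule measurable_restrict_space1)
  have comp: "(\<lambda>t. f (cis (2 * pi * t))) \<in> borel_measurable lborel"
    using measurable_compose[OF measurable_circle_parametrization f']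
    by (simp add: measurable_cong_sets[OF sets_uniform_measure refl])
  show "integrable circle_measure f \<longleftrightarrow> set_integrable lborel {0..1} (\<lambda>t. f (cis (2 * pi * t)))"
    unfolding circle_measure_def set_integrable_def
    by (subst integrable_distr_eq[OF measurable_circle_parametrization f'])
      (use comp in \<open>simp add: uniform_unit_interval integrable_density\<close>)
  show "integral\<^sup>L circle_measure f = (LINT t:{0..1}|lborel. f (cis (2 * pi * t)))"
    unfolding circle_measure_def set_lebesgue_integral_def
    by (subst integral_distr[OF measurable_circle_parametrization f'])
      (use comp in \<open>simp add: uniform_unit_interval integral_density\<close>)
qed

text \<open>The singular point \<open>w = 1\<close> is hit only by the parameters 0 and 1, which
  form a null set.\<close>

lemma AE_circle_measure: "AE w in circle_measure. cmod w = 1 \<and> w \<noteq> 1"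
proof -
  have "AE t in lborel. t \<in> {0..1::real} \<longrightarrow> cis (2 * pi * t) \<noteq> 1"
    using AE_lborel_singleton[of 0] AE_lborel_singleton[of 1]
  proof eventually_elim
    case (elim t)
    show ?case
    proof (intro impI notI)
      assume t: "t \<in> {0..1}" and "cis (2 * pi * t) = 1"
      then have "cos (2 * pi * t) = 1" by (simp add: complex_eq_iff)
      then obtain n :: int where "2 * pi * t = n * 2 * pi"
        by (auto simp: cos_one_2pi_int)
      then have "t = of_int n" by simp
      then show False using t elim by auto
    qed
  qed
  then have "AE t in uniform_measure lborel {0..1}. cis (2 * pi * t) \<noteq> 1"
    by (intro AE_uniform_measureI) auto
  then have "AE w in circle_measure. w \<noteq> 1"
    unfolding circle_measure_def
    by (subst AE_distr_iff[OF measurable_circle_parametrization])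
      (auto simp: sets_restrict_space space_restrict_space intro!: image_eqI[of _ _ "- {1}"])
  then show ?thesis
    using AE_space[of circle_measure] by eventually_elim (simp add: space_circle_measure)
qed

lemma borel_measurable_power_int: "(\<lambda>w::complex. w powi k) \<in> borel_measurable borel"
  unfolding power_int_def by (cases "k \<ge> 0") auto

lemma integral_circle_powi: "(\<integral>w. w powi k \<partial>circle_measure) = (if k = 0 then 1 else 0)"
proof (cases "k = 0")
  case True
  interpret prob_space circle_measure by (rule prob_space_circle_measure)
  show ?thesis using True by (simp add: prob_space)
next
  case False
  define c where "c = \<i> * complex_of_real (2 * pi * of_int k)"
  have c: "c \<noteq> 0" using False by (simp add: c_def)
  have powi: "cis (2 * pi * t) powi k = exp (of_real t * c)" for t
    unfolding cis_power_int by (simp add: cis_conv_exp c_def mult_ac)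
  have "(\<integral>t. indicator {0..1} t *\<^sub>R exp (of_real t * c) \<partial>lborel) = exp (of_real 1 * c) / c - exp (of_real 0 * c) / c"
    by (rule integral_FTC_Icc)
      (auto intro!: derivative_eq_intros continuous_intros has_vector_derivative_real_field simp: c)
  also have "exp (of_real 1 * c) = cis (2 * pi * of_int k)"
    by (simp add: cis_conv_exp c_def)
  also have "\<dots> = 1"
    using cis_multiple_2pi[of "of_int k"] by simp
  finally have "(\<integral>t. indicator {0..1} t *\<^sub>R exp (of_real t * c) \<partial>lborel) = 0" by simp
  then show ?thesis
    using False
    by (simp add: integral_circle_measure[OF borel_measurable_power_int] powi set_lebesgue_integral_def)
qed

section \<open>Integrability of powers of the boundary values\<close>

lemma sin_pi_ge:
  assumes "0 \<le> t" "t \<le> 1 / 2"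
  shows "2 * t \<le> sin (pi * t)"
proof -
  have "convex_on {0..pi} (\<lambda>x. - sin x)"
    by (rule f''_ge0_imp_convex[where f' = "\<lambda>x. - cos x" and f'' = sin])
      (auto intro!: derivative_eq_intros simp: sin_ge_zero)
  \<comment> \<open>Jordan's inequality: the sine lies above its chord from 0 to
    \<open>pi / 2\<close>, evaluated with weight \<open>2 * t\<close> at the right end.\<close>
  from convex_onD[OF this, of "2 * t" 0 "pi / 2"] assms show ?thesis
    by (simp add: mult_ac)
qed

lemma cmod_1_minus_cis: "0 \<le> t \<Longrightarrow> t \<le> 1 \<Longrightarrow> cmod (1 - cis (2 * pi * t)) = 2 * sin (pi * t)"
proof -
  assume t: "0 \<le> t" "t \<le> 1"
  have "(cmod (1 - cis (2 * pi * t)))\<^sup>2 = (1 - cos (2 * (pi * t)))\<^sup>2 + (sin (2 * (pi * t)))\<^sup>2"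
    by (simp add: cmod_power2 mult.assoc)
  also have "\<dots> = 2 * (1 - cos (2 * (pi * t)))"
    using sin_cos_squared_add[of "2 * (pi * t)"] by (simp add: power2_eq_square algebra_simps)
  also have "\<dots> = (2 * sin (pi * t))\<^sup>2"
    unfolding cos_double_sin by (simp add: power2_eq_square)
  finally show ?thesis
    by (rule power2_eq_imp_eq) (use sin_ge_zero[of "pi * t"] t in \<open>auto simp: mult_left_le\<close>)
qed

text \<open>The distance to 1 dominates the distance of \<open>t\<close> to the nearer endpoint;
  adding the contributions of both ends gives one majorant on the entire interval.\<close>

lemma inverse_sqrt_cmod_1_minus_cis_le:
  assumes "0 < t" "t < 1"
  shows "cmod (1 - cis (2 * pi * t)) powr (- 1 / 2) \<le> t powr (- 1 / 2) + (1 - t) powr (- 1 / 2)"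
proof (cases "t \<le> 1 / 2")
  case True
  then have "cmod (1 - cis (2 * pi * t)) \<ge> t"
    using sin_pi_ge[of t] assms by (simp add: cmod_1_minus_cis)
  then have "cmod (1 - cis (2 * pi * t)) powr (- 1 / 2) \<le> t powr (- 1 / 2)"
    using assms by (intro powr_mono2') auto
  then show ?thesis by (simp add: add_increasing2)
next
  case False
  have "sin (pi * (1 - t)) = sin (pi * t)"
    using sin_pi_minus[of "pi * t"] by (simp add: right_diff_distrib)
  then have "cmod (1 - cis (2 * pi * t)) \<ge> 1 - t"
    using sin_pi_ge[of "1 - t"] assms False by (simp add: cmod_1_minus_cis)
  then have "cmod (1 - cis (2 * pi * t)) powr (- 1 / 2) \<le> (1 - t) powr (- 1 / 2)"
    using assms by (intro powr_mono2') auto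
  then show ?thesis by (simp add: add_increasing)
qed

lemma integrable_inverse_sqrt: "integrable circle_measure (\<lambda>w. cmod (1 - w) powr (- 1 / 2))"
proof -
  define h :: "real \<Rightarrow> real" where "h t = indicator {0..1} t *\<^sub>R t powr (- 1 / 2)" for t
  have "(\<lambda>t::real. t powr (- 1 / 2)) absolutely_integrable_on {0..1}"
    by (intro nonnegative_absolutely_integrable_1 integrable_on_powr_from_0) auto
  then have h: "integrable lborel h"
    unfolding set_integrable_def h_def[abs_def]
    by (subst (asm) integrable_completion) auto
  have h': "integrable lborel (\<lambda>t. h (1 - t))"
    using lborel_integrable_real_affine[OF h, of "- 1" 1] by simp
  have meas: "(\<lambda>w::complex. cmod (1 - w) powr (- 1 / 2)) \<in> borel_measurable borel"
    by measurable
  have "AE t in lborel. norm (indicator {0..1} t *\<^sub>R cmod (1 - cis (2 * pi * t)) powr (- 1 / 2))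
      \<le> norm (h t + h (1 - t))"
    using AE_lborel_singleton[of 0] AE_lborel_singleton[of 1]
  proof eventually_elim
    case (elim t)
    show ?case
      using inverse_sqrt_cmod_1_minus_cis_le[of t] elim by (auto simp: h_def split: split_indicator)
  qed
  moreover have "(\<lambda>t. cis (2 * pi * t)) \<in> borel_measurable lborel"
    unfolding cis_conv_exp by (auto intro!: borel_measurable_continuous_onI continuous_intros)
  then have "(\<lambda>t. indicator {0..1} t *\<^sub>R cmod (1 - cis (2 * pi * t)) powr (- 1 / 2)) \<in> borel_measurable lborel"
    by measurable
  ultimately show ?thesis
    unfolding integrable_circle_measure[OF meas] set_integrable_def
    using Bochner_Integration.integrable_bound[OF Bochner_Integration.integrable_add[OF h h']] by blast
qed

lemma borel_measurable_symbol_disc [measurable]: "symbol_disc \<in> borel_measurable borel"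
  unfolding symbol_disc_def[abs_def] by measurable

text \<open>This is \<open>x \<le> exp x\<close> at \<open>x = u / (2 * p)\<close>, raised to the
  power \<open>p\<close>. The exponent \<open>u / 2\<close> is independent of \<open>p\<close>, so
  the single majorant \<open>cmod (1 - w) powr (- 1 / 2)\<close> serves every
  \<open>p\<close>.\<close>

lemma powr_le_exp_half:
  fixes u p :: real
  assumes "0 \<le> u" "0 < p"
  shows "u powr p \<le> (2 * p) powr p * exp (u / 2)"
proof -
  have "u powr p = (2 * p) powr p * (u / (2 * p)) powr p"
    using assms by (simp flip: powr_mult)
  moreover have "u / (2 * p) \<le> exp (u / (2 * p))"
    using exp_ge_add_one_self[of "u / (2 * p)"] by linarith
  then have "(u / (2 * p)) powr p \<le> exp (u / (2 * p)) powr p"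
    using assms by (intro powr_mono2) auto
  moreover have "exp (u / (2 * p)) powr p = exp (u / 2)"
    using assms by (simp add: powr_def)
  ultimately show ?thesis by (simp add: mult_left_mono)
qed

text \<open>
  The bound is uniform in the radius, because \<open>cmod (1 - w) \<le> 2 * cmod (1 - r * w)\<close> on the circle.
\<close>

lemma cmod_symbol_disc_powr_le:
  assumes w: "cmod w = 1" "w \<noteq> 1" and r: "0 \<le> r" "r \<le> 1" and p: "0 < p"
  shows "cmod (symbol_disc (of_real r * w)) powr p
    \<le> (2 * p) powr p * exp ((3 + pi + ln 4) / 2) * cmod (1 - w) powr (- 1 / 2)"
proof -
  define v where "v = 1 - of_real r * w"
  \<comment> \<open>Passing from \<open>w\<close> to \<open>r * w\<close> costs
    \<open>1 - r\<close>, which is itself at most \<open>cmod v\<close>.\<close>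
  have "cmod (1 - w) \<le> cmod v + cmod (of_real r * w - w)"
    using norm_triangle_ineq[of v "of_real r * w - w"] by (simp add: v_def)
  also have "cmod (of_real r * w - w) = 1 - r"
  proof -
    have "of_real r * w - w = - (of_real (1 - r) * w)" by (simp add: algebra_simps)
    then show ?thesis using w r by (simp add: norm_mult del: of_real_diff)
  qed
  also have "1 - r \<le> cmod v"
    using norm_triangle_ineq2[of 1 "of_real r * w"] w r by (simp add: v_def norm_mult)
  finally have v_ge: "cmod (1 - w) / 2 \<le> cmod v" by simp
  have pos: "0 < cmod (1 - w)" using w by simp
  have v_le: "cmod v \<le> 2"
    using norm_triangle_ineq4[of 1 "of_real r * w"] w r by (simp add: v_def norm_mult)
  have w_le: "cmod (1 - w) \<le> 2"
    using norm_triangle_ineq4[of 1 w] w by simp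
  have "v \<noteq> 0" using v_ge pos by auto
  have ln4: "ln (4::real) = 2 * ln 2"
    using ln_realpow[of 2 2] by simp
  have "ln (cmod (1 - w) / 2) \<le> ln (cmod v)"
    using v_ge pos \<open>v \<noteq> 0\<close> by (subst ln_le_cancel_iff) auto
  then have l1: "- ln (cmod v) \<le> ln 2 - ln (cmod (1 - w))"
    using pos by (simp add: ln_div)
  have l2: "ln (cmod v) \<le> ln 2"
    using v_le \<open>v \<noteq> 0\<close> by (subst ln_le_cancel_iff) auto
  have l3: "ln (cmod (1 - w)) \<le> ln 2"
    using w_le pos by (subst ln_le_cancel_iff) auto
  \<comment> \<open>One \<open>ln 2\<close> suffices if the logarithm is negative; if it is
    positive, the second \<open>ln 2\<close> compensates for
    \<open>ln (cmod (1 - w)) \<le> ln 2\<close>.\<close>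
  have "\<bar>ln (cmod v)\<bar> \<le> ln 4 - ln (cmod (1 - w))"
    using l1 l2 l3 ln4 ln_gt_zero[of "2::real"] by linarith
  moreover have "cmod (Ln v) \<le> \<bar>ln (cmod v)\<bar> + pi"
    using cmod_le[of "Ln v"] \<open>v \<noteq> 0\<close> Im_Ln_le_pi[of v] mpi_less_Im_Ln[of v] by auto
  moreover have "cmod (symbol_disc (of_real r * w)) \<le> 3 + cmod (Ln v)"
    using norm_triangle_ineq4[of 3 "Ln v"] by (simp add: symbol_disc_def v_def)
  ultimately have le: "cmod (symbol_disc (of_real r * w)) \<le> (3 + pi + ln 4) - ln (cmod (1 - w))"
    (is "_ \<le> ?u") by simp
  then have "cmod (symbol_disc (of_real r * w)) powr p \<le> ?u powr p"
    using p by (intro powr_mono2) auto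
  also have "\<dots> \<le> (2 * p) powr p * exp (?u / 2)"
    using order_trans[OF norm_ge_zero le] p by (rule powr_le_exp_half)
  also have "exp (?u / 2) = exp ((3 + pi + ln 4) / 2) * cmod (1 - w) powr (- 1 / 2)"
    using pos by (simp add: powr_def diff_divide_distrib flip: exp_add)
  finally show ?thesis by (simp add: mult.assoc)
qed

lemma integrable_symbol_disc_powr:
  assumes "0 < p"
  shows "integrable circle_measure (\<lambda>w. cmod (symbol_disc w) powr p)"
proof (rule Bochner_Integration.integrable_bound)
  show "integrable circle_measure (\<lambda>w. (2 * p) powr p * exp ((3 + pi + ln 4) / 2) * cmod (1 - w) powr (- 1 / 2))"
    by (intro integrable_mult_right integrable_inverse_sqrt)
  show "(\<lambda>w. cmod (symbol_disc w) powr p) \<in> borel_measurable circle_measure"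
    by (intro measurable_circle_measure) measurable
  show "AE w in circle_measure. norm (cmod (symbol_disc w) powr p)
      \<le> norm ((2 * p) powr p * exp ((3 + pi + ln 4) / 2) * cmod (1 - w) powr (- 1 / 2))"
    using AE_circle_measure
  proof eventually_elim
    case (elim w)
    show ?case
      using cmod_symbol_disc_powr_le[of w 1 p] elim assms by (simp add: abs_mult)
  qed
qed

section \<open>Fourier coefficients of the boundary values\<close>

lemma powi_cnj_powi:
  assumes "cmod w = 1"
  shows "w ^ k * cnj (w powi m) = w powi (int k - m)"
proof -
  have "w \<noteq> 0" using assms by auto
  have "w * cnj w = 1"
    using complex_norm_square[of w] assms by simp
  then have "cnj w = inverse w"
    by (metis inverse_unique)
  then show ?thesis
    using \<open>w \<noteq> 0\<close> by (simp add: power_int_diff power_int_inverse divide_inverse)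
qed

lemma borel_measurable_cnj_powi [measurable]: "(\<lambda>w. cnj (w powi m)) \<in> borel_measurable borel"
  by (rule measurable_compose[OF borel_measurable_power_int])
    (auto intro!: borel_measurable_continuous_onI continuous_intros)

text \<open>For \<open>r < 1\<close> the Taylor series converges absolutely on the circle of radius
  \<open>r\<close> and may be integrated termwise; orthogonality leaves one term. At
  \<open>r = 1\<close> this fails, as the coefficients \<open>1 / k\<close> are not
  summable.\<close>

lemma integral_symbol_disc_radius:
  assumes r: "0 \<le> r" "r < 1"
  shows "(\<integral>w. symbol_disc (of_real r * w) * cnj (w powi m) \<partial>circle_measure)
    = (if 0 \<le> m then symbol_disc_coeff (nat m) * of_real r ^ nat m else 0)"
proof -
  interpret prob_space circle_measure by (rule prob_space_circle_measure)
  define f where "f k w = symbol_disc_coeff k * of_real r ^ k * (w ^ k * cnj (w powi m))" for k w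
  have meas: "f k \<in> borel_measurable circle_measure" for k
    unfolding f_def by (intro measurable_circle_measure) measurable
  have norm_f: "AE w in circle_measure. norm (f k w) = cmod (symbol_disc_coeff k) * r ^ k" for k
    using AE_circle_measure
    by eventually_elim (use r in \<open>auto simp: f_def norm_mult norm_power norm_power_int\<close>)
  have int: "integrable circle_measure (f k)" for k
    by (rule integrable_const_bound[OF _ meas, where B = "cmod (symbol_disc_coeff k) * r ^ k"])
      (use norm_f[of k] in eventually_elim, simp)
  have int_norm: "(\<integral>w. norm (f k w) \<partial>circle_measure) = cmod (symbol_disc_coeff k) * r ^ k" for k
  proof -
    have "(\<integral>w. norm (f k w) \<partial>circle_measure) = (\<integral>w. cmod (symbol_disc_coeff k) * r ^ k \<partial>circle_measure)"
      by (rule integral_cong_AE) (use meas norm_f in auto)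
    then show ?thesis by (simp add: prob_space)
  qed
  have summable: "summable (\<lambda>k. cmod (symbol_disc_coeff k) * r ^ k)"
  proof (rule summable_comparison_test')
    show "summable (\<lambda>k. 3 * r ^ k)"
      using r by (intro summable_mult summable_geometric) auto
    fix k
    have "cmod (symbol_disc_coeff k) \<le> 3"
      by (auto simp: symbol_disc_coeff_def norm_divide divide_simps)
    then show "norm (cmod (symbol_disc_coeff k) * r ^ k) \<le> 3 * r ^ k"
      using r by (simp add: abs_mult mult_right_mono)
  qed
  have "(\<lambda>k. integral\<^sup>L circle_measure (f k)) sums (\<integral>w. (\<Sum>k. f k w) \<partial>circle_measure)"
  proof (rule sums_integral[OF int])
    have "AE w in circle_measure. \<forall>k. norm (f k w) = cmod (symbol_disc_coeff k) * r ^ k"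
      using norm_f by (simp add: AE_all_countable)
    then show "AE w in circle_measure. summable (\<lambda>k. norm (f k w))"
      by eventually_elim (simp add: summable)
    show "summable (\<lambda>k. \<integral>w. norm (f k w) \<partial>circle_measure)"
      by (simp add: int_norm summable)
  qed
  moreover have "integral\<^sup>L circle_measure (f k) = (if m = int k then symbol_disc_coeff k * of_real r ^ k else 0)" for k
  proof -
    have "integral\<^sup>L circle_measure (f k)
        = (\<integral>w. symbol_disc_coeff k * of_real r ^ k * w powi (int k - m) \<partial>circle_measure)"
      by (rule Bochner_Integration.integral_cong[OF refl])
        (simp add: f_def space_circle_measure powi_cnj_powi del: complex_cnj_power_int)
    then show ?thesis by (simp add: integral_circle_powi)
  qed
  moreover have "(\<integral>w. (\<Sum>k. f k w) \<partial>circle_measure)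
      = (\<integral>w. symbol_disc (of_real r * w) * cnj (w powi m) \<partial>circle_measure)"
  proof (rule Bochner_Integration.integral_cong[OF refl])
    fix w assume "w \<in> space circle_measure"
    then have "cmod (of_real r * w) < 1"
      using r by (simp add: space_circle_measure norm_mult)
    from sums_mult2[OF symbol_disc_sums[OF this], of "cnj (w powi m)"]
    have "(\<lambda>k. f k w) sums (symbol_disc (of_real r * w) * cnj (w powi m))"
      by (simp add: f_def power_mult_distrib mult_ac)
    then show "(\<Sum>k. f k w) = symbol_disc (of_real r * w) * cnj (w powi m)"
      by (simp add: sums_iff)
  qed
  ultimately have sums: "(\<lambda>k. if m = int k then symbol_disc_coeff k * of_real r ^ k else 0) sums
      (\<integral>w. symbol_disc (of_real r * w) * cnj (w powi m) \<partial>circle_measure)"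
    by simp
  show ?thesis
  proof (cases "0 \<le> m")
    case True
    then have eq: "(m = int k) = (k = nat m)" for k by auto
    show ?thesis
      using sums_unique2[OF sums[unfolded eq] sums_single] True by simp
  next
    case False
    then have eq: "(m = int k) = False" for k by auto
    show ?thesis
      using sums_unique2[OF sums[unfolded eq if_False] sums_zero] False by simp
  qed
qed

text \<open>The radius tends to 1 under the integral, by dominated convergence with the majorant
  that does not depend on the radius.\<close>

lemma integral_symbol_disc:
  "integrable circle_measure (\<lambda>w. symbol_disc w * cnj (w powi m))"
  "(\<integral>w. symbol_disc w * cnj (w powi m) \<partial>circle_measure)
    = (if 0 \<le> m then symbol_disc_coeff (nat m) else 0)"
proof -
  define r where "r i = 1 - inverse (real (Suc i))" for i
  have r: "0 \<le> r i" "r i < 1" for i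
    by (simp_all add: r_def divide_simps)
  have lim_r: "(\<lambda>i. complex_of_real (r i)) \<longlonglongrightarrow> 1"
    using tendsto_of_real[OF LIMSEQ_inverse_real_of_nat_add_minus[of 1], where 'a = complex]
    by (simp add: r_def)
  let ?s = "\<lambda>i w. symbol_disc (of_real (r i) * w) * cnj (w powi m)"
  let ?f = "\<lambda>w. symbol_disc w * cnj (w powi m)"
  let ?h = "\<lambda>w. (2 * 1) powr 1 * exp ((3 + pi + ln 4) / 2) * cmod (1 - w) powr (- 1 / 2)"
  have meas: "?f \<in> borel_measurable circle_measure"
    by (intro measurable_circle_measure) measurable
  have meas_s: "?s i \<in> borel_measurable circle_measure" for i
    by (intro measurable_circle_measure) measurable
  have int_h: "integrable circle_measure ?h"
    by (intro integrable_mult_right integrable_inverse_sqrt)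
  have lim: "AE w in circle_measure. (\<lambda>i. ?s i w) \<longlonglongrightarrow> ?f w"
    using AE_circle_measure
  proof eventually_elim
    case (elim w)
    \<comment> \<open>On the circle, \<open>1 - w\<close> meets the branch cut only at
      \<open>w = 1\<close>.\<close>
    have "1 - w \<notin> \<real>\<^sub>\<le>\<^sub>0"
    proof
      assume "1 - w \<in> \<real>\<^sub>\<le>\<^sub>0"
      then have "1 \<le> Re w" "Im w = 0"
        by (auto simp: complex_nonpos_Reals_iff)
      moreover have "\<bar>Re w\<bar> = 1"
        using elim \<open>Im w = 0\<close> by (simp add: cmod_eq_Re)
      ultimately show False
        using elim by (auto simp: complex_eq_iff)
    qed
    then have "isCont symbol_disc w"
      unfolding symbol_disc_def by (intro continuous_intros) auto
    moreover have "(\<lambda>i. of_real (r i) * w) \<longlonglongrightarrow> w"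
      using tendsto_mult_right[OF lim_r, of w] by simp
    ultimately show ?case
      by (intro tendsto_mult tendsto_const isCont_tendsto_compose[of w symbol_disc])
  qed
  have bound: "AE w in circle_measure. norm (?s i w) \<le> ?h w" for i
    using AE_circle_measure
  proof eventually_elim
    case (elim w)
    then show ?case
      using cmod_symbol_disc_powr_le[of w "r i" 1] r[of i] by (simp add: norm_mult norm_power_int)
  qed
  show "integrable circle_measure ?f"
    by (rule integrable_dominated_convergence[OF meas meas_s int_h lim bound])
  have "(\<lambda>i. integral\<^sup>L circle_measure (?s i)) \<longlonglongrightarrow> integral\<^sup>L circle_measure ?f"
    by (rule integral_dominated_convergence[OF meas meas_s int_h lim bound])
  then have "(\<lambda>i. if 0 \<le> m then symbol_disc_coeff (nat m) * of_real (r i) ^ nat m else 0)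
      \<longlonglongrightarrow> integral\<^sup>L circle_measure ?f"
    by (simp only: integral_symbol_disc_radius[OF r])
  moreover have "(\<lambda>i. if 0 \<le> m then symbol_disc_coeff (nat m) * of_real (r i) ^ nat m else 0)
      \<longlonglongrightarrow> (if 0 \<le> m then symbol_disc_coeff (nat m) else 0)"
    using tendsto_mult_left[OF tendsto_power[OF lim_r, of "nat m"], of "symbol_disc_coeff (nat m)"] by simp
  ultimately show "integral\<^sup>L circle_measure ?f = (if 0 \<le> m then symbol_disc_coeff (nat m) else 0)"
    by (rule LIMSEQ_unique)
qed

lemma integral_circle_cnj_powi:
  "integrable circle_measure (\<lambda>w. cnj (w powi m))"
  "(\<integral>w. cnj (w powi m) \<partial>circle_measure) = (if m = 0 then 1 else 0)"
proof -
  interpret prob_space circle_measure by (rule prob_space_circle_measure)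
  show "integrable circle_measure (\<lambda>w. cnj (w powi m))"
    by (rule integrable_const_bound[where B = 1])
      (auto intro!: measurable_circle_measure AE_I2 simp: space_circle_measure norm_power_int
        simp del: complex_cnj_power_int)
  have "(\<integral>w. cnj (w powi m) \<partial>circle_measure) = (\<integral>w. w powi (- m) \<partial>circle_measure)"
    by (rule Bochner_Integration.integral_cong[OF refl])
      (use powi_cnj_powi[of _ 0 m] in \<open>auto simp: space_circle_measure\<close>)
  then show "(\<integral>w. cnj (w powi m) \<partial>circle_measure) = (if m = 0 then 1 else 0)"
    by (simp add: integral_circle_powi)
qed

section \<open>Fourier coefficients on the torus\<close>

interpretation torus: product_prob_space "\<lambda>_::nat. circle_measure" UNIV
  by (intro product_prob_spaceI prob_space_circle_measure)

lemma measurable_torus_component: "(\<lambda>z. z j) \<in> measurable torus_measure circle_measure"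
  unfolding torus_measure_def by measurable

lemma distr_torus_component: "distr torus_measure circle_measure (\<lambda>z. z j) = circle_measure"
  unfolding torus_measure_def by (rule distr_PiM_component) (auto intro: prob_space_circle_measure)

text \<open>The integrand depends on finitely many coordinates. Inserting \<open>restrict\<close>
  exhibits it as a function of the projection to \<open>J\<close>, whose image measure is a finite
  product.\<close>

lemma integral_torus_prod:
  fixes f :: "nat \<Rightarrow> complex \<Rightarrow> complex"
  assumes "finite J" "\<And>j. j \<in> J \<Longrightarrow> integrable circle_measure (f j)"
  shows "(\<integral>z. (\<Prod>j\<in>J. f j (z j)) \<partial>torus_measure) = (\<Prod>j\<in>J. integral\<^sup>L circle_measure (f j))"
proof -
  have meas [measurable]: "f j \<in> borel_measurable circle_measure" if "j \<in> J" for j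
    using assms(2)[OF that] by simp
  have "(\<integral>z. (\<Prod>j\<in>J. f j (z j)) \<partial>torus_measure)
      = (\<integral>z. (\<Prod>j\<in>J. f j (restrict z J j)) \<partial>torus_measure)"
    by (intro Bochner_Integration.integral_cong prod.cong) auto
  also have "\<dots> = (\<integral>z. (\<Prod>j\<in>J. f j (z j))
      \<partial>(distr torus_measure (\<Pi>\<^sub>M j\<in>J. circle_measure) (\<lambda>z. restrict z J)))"
    unfolding torus_measure_def
    by (rule integral_distr[OF measurable_restrict_subset[OF subset_UNIV], symmetric])
      (auto intro!: borel_measurable_prod measurable_compose[OF _ meas])
  also have "distr torus_measure (\<Pi>\<^sub>M j\<in>J. circle_measure) (\<lambda>z. restrict z J) = (\<Pi>\<^sub>M j\<in>J. circle_measure)"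
    unfolding torus_measure_def by (rule torus.distr_PiM_restrict_finite) (use assms(1) in auto)
  also have "(\<integral>z. (\<Prod>j\<in>J. f j (z j)) \<partial>(\<Pi>\<^sub>M j\<in>J. circle_measure))
      = (\<Prod>j\<in>J. integral\<^sup>L circle_measure (f j))"
    by (rule torus.product_integral_prod) (use assms in auto)
  finally show ?thesis .
qed

text \<open>The Bohr lift of the symbol: coordinate 0 belongs to the prime 2.\<close>

definition symbol_torus :: "(nat \<Rightarrow> complex) \<Rightarrow> complex" where
  "symbol_torus z = symbol_disc (z 0)"

lemma fourier_coeff_symbol_torus:
  assumes "finitely_supported \<alpha>"
  shows "fourier_coeff symbol_torus \<alpha>
    = (if (\<forall>j>0. \<alpha> j = 0) \<and> 0 \<le> \<alpha> 0 then symbol_disc_coeff (nat (\<alpha> 0)) else 0)"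
proof -
  \<comment> \<open>The index 0 is added because the factor \<open>symbol_disc (z 0)\<close> is
    present even if \<open>\<alpha> 0 = 0\<close>.\<close>
  define J where "J = insert 0 {j. \<alpha> j \<noteq> 0}"
  define f where "f j w = (if j = 0 then symbol_disc w else 1) * cnj (w powi \<alpha> j)" for j :: nat and w
  have J: "finite J" "0 \<in> J" using assms by (auto simp: J_def finitely_supported_def)
  have int: "integrable circle_measure (f j)" for j
    unfolding f_def[abs_def] using integral_symbol_disc(1) integral_circle_cnj_powi(1) by (cases "j = 0") simp_all
  have val: "integral\<^sup>L circle_measure (f j) = (if j = 0
      then (if 0 \<le> \<alpha> 0 then symbol_disc_coeff (nat (\<alpha> 0)) else 0) else if \<alpha> j = 0 then 1 else 0)" for j
    unfolding f_def[abs_def] using integral_symbol_disc(2) integral_circle_cnj_powi(2) by (cases "j = 0") simp_all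
  have "symbol_torus z * cnj (torus_character \<alpha> z) = (\<Prod>j\<in>J. f j (z j))" for z
  proof -
    have "torus_character \<alpha> z = (\<Prod>j\<in>J. z j powi \<alpha> j)"
      unfolding torus_character_def J_def
      using assms by (intro prod.mono_neutral_left) (auto simp: finitely_supported_def)
    moreover have "symbol_torus z = (\<Prod>j\<in>J. if j = 0 then symbol_disc (z j) else 1)"
      using J by (simp add: symbol_torus_def prod.delta)
    ultimately show ?thesis
      by (simp add: f_def prod.distrib del: complex_cnj_power_int)
  qed
  then have "fourier_coeff symbol_torus \<alpha> = (\<Prod>j\<in>J. integral\<^sup>L circle_measure (f j))"
    unfolding fourier_coeff_def using integral_torus_prod[OF J(1) int] by simp
  also have "\<dots> = (if 0 \<le> \<alpha> 0 then symbol_disc_coeff (nat (\<alpha> 0)) else 0)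
      * (\<Prod>j\<in>J - {0}. if \<alpha> j = 0 then 1 else 0)"
    using J by (subst prod.remove[of J 0]) (auto simp: val intro!: prod.cong)
  also have "(\<Prod>j\<in>J - {0}. if \<alpha> j = 0 then 1 else 0) = (if \<forall>j>0. \<alpha> j = 0 then 1 else 0 :: complex)"
  proof (cases "\<forall>j>0. \<alpha> j = 0")
    case True
    then show ?thesis by (simp add: prod.neutral)
  next
    case False
    then obtain j where "j > 0" "\<alpha> j \<noteq> 0" by auto
    then have "(\<Prod>j\<in>J - {0}. if \<alpha> j = 0 then 1 else 0) = (0::complex)"
      using J(1) by (intro prod_zero) (auto simp: J_def)
    then show ?thesis using False by simp
  qed
  finally show ?thesis by auto
qed

lemma symbol_torus_in_hp_torus:
  assumes "1 \<le> p"
  shows "symbol_torus \<in> hp_torus p"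
proof -
  have "symbol_torus \<in> borel_measurable torus_measure"
    unfolding symbol_torus_def[abs_def]
    by (rule measurable_compose[OF measurable_torus_component]) (simp add: measurable_circle_measure)
  moreover have "integrable torus_measure (\<lambda>z. cmod (symbol_torus z) powr p)"
    unfolding symbol_torus_def
    using integrable_distr[OF measurable_torus_component[of 0], of "\<lambda>w. cmod (symbol_disc w) powr p"]
      integrable_symbol_disc_powr[of p] assms
    by (simp add: distr_torus_component)
  moreover have "fourier_coeff symbol_torus \<alpha> = 0"
    if "finitely_supported \<alpha>" "\<not> (\<forall>j. 0 \<le> \<alpha> j)" for \<alpha>
  proof -
    have "\<not> ((\<forall>j>0. \<alpha> j = 0) \<and> 0 \<le> \<alpha> 0)"
      using that(2) by (metis gr0I order_refl)
    then show ?thesis by (simp only: fourier_coeff_symbol_torus[OF that(1)] if_False)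
  qed
  ultimately show ?thesis by (simp add: hp_torus_def lp_torus_def)
qed

section \<open>Prime exponents and the powers of 2\<close>

lemma finitely_supported_prime_exponents:
  assumes "n \<ge> 1"
  shows "finitely_supported (prime_exponents n)"
proof -
  have "enumerate {p::nat. prime p} ` {j. prime_exponents n j \<noteq> 0} \<subseteq> prime_factors n"
    using assms enumerate_in_set[OF primes_infinite]
    by (auto simp: prime_exponents_def prime_factors_multiplicity)
  moreover have "inj_on (enumerate {p::nat. prime p}) A" for A
    using inj_enumerate[OF primes_infinite] by (rule inj_on_subset) simp
  ultimately show ?thesis
    unfolding finitely_supported_def using finite_imageD finite_subset finite_set_mset by metis
qed

lemma enumerate_primes_0: "enumerate {p::nat. prime p} 0 = 2"
  unfolding enumerate_0 by (rule Least_equality) (auto dest: prime_ge_2_nat)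

text \<open>Matches the frequencies carried by coordinate 0 of the torus with the support of
  \<open>lacunary\<close>.\<close>

lemma prime_exponents_only_two_iff:
  assumes "n \<ge> 1"
  shows "(\<forall>j>0. prime_exponents n j = 0) \<longleftrightarrow> n \<in> range (\<lambda>k. 2 ^ k)"
proof
  assume only: "\<forall>j>0. prime_exponents n j = 0"
  have "p = 2" if "p \<in> prime_factors n" for p
  proof (rule ccontr)
    assume "p \<noteq> 2"
    have "prime p" using that by auto
    then obtain j where j: "enumerate {p::nat. prime p} j = p"
      using enumerate_Ex[OF primes_infinite, of p] by blast
    then have "j > 0" using \<open>p \<noteq> 2\<close> enumerate_primes_0 by (cases j) auto
    then have "multiplicity p n = 0"
      using only j by (auto simp: prime_exponents_def)
    then show False using that by (simp add: prime_factors_multiplicity)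
  qed
  then have sub: "prime_factors n \<subseteq> {2}" by auto
  have "n = (\<Prod>p\<in>prime_factors n. p ^ multiplicity p n)"
    using prime_factorization_nat assms by simp
  also have "\<dots> = (\<Prod>p\<in>{2}. p ^ multiplicity p n)"
    using sub by (intro prod.mono_neutral_left) (auto simp: prime_factors_multiplicity)
  finally show "n \<in> range (\<lambda>k. 2 ^ k)" by auto
next
  assume "n \<in> range (\<lambda>k. 2 ^ k)"
  then obtain k where n: "n = 2 ^ k" by auto
  show "\<forall>j>0. prime_exponents n j = 0"
  proof (intro allI impI)
    fix j :: nat assume "j > 0"
    define p where "p = enumerate {p::nat. prime p} j"
    have "prime p" using enumerate_in_set[OF primes_infinite, of j] by (simp add: p_def)
    have "p \<noteq> 2"
      using enumerate_mono[OF \<open>j > 0\<close> primes_infinite] enumerate_primes_0 by (simp add: p_def)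
    then have "\<not> p dvd 2"
      using \<open>prime p\<close> primes_dvd_imp_eq two_is_prime_nat by blast
    then have "\<not> p dvd n"
      using \<open>prime p\<close> n prime_dvd_power by blast
    then show "prime_exponents n j = 0"
      by (simp add: prime_exponents_def p_def not_dvd_imp_multiplicity_0)
  qed
qed

lemma symbol_in_hardy_dirichlet:
  assumes "1 \<le> p"
  shows "in_hardy_dirichlet p symbol"
proof -
  have "fourier_coeff symbol_torus (prime_exponents n) = lacunary symbol_disc_coeff n" if "n \<ge> 1" for n
    using fourier_coeff_symbol_torus[OF finitely_supported_prime_exponents[OF that]]
      prime_exponents_only_two_iff[OF that]
    by (simp add: lacunary_def) (simp add: prime_exponents_def enumerate_primes_0)
  then show ?thesis
    unfolding in_hardy_dirichlet_def
    using symbol_convergent symbol_dirichlet_expansion symbol_torus_in_hp_torus[OF assms] by blast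
qed

theorem theorem2p1:
  shows "\<exists>\<phi> :: complex \<Rightarrow> complex.
      \<phi> ` halfplane 0 \<subseteq> halfplane 0 \<and>
      convergent_dirichlet_series \<phi> \<and>
      induces_bounded_composition_operator \<phi> \<and>
      \<not> in_wiener_algebra \<phi> \<and>
      (\<forall>p::real. 1 \<le> p \<longrightarrow> in_hardy_dirichlet p \<phi>) \<and>
      compact_operator (composition_operator \<phi>) \<and>
      absolutely_summing (composition_operator \<phi>)"
  using symbol_maps symbol_convergent symbol.induces_bounded symbol_not_in_wiener_algebra
    symbol_in_hardy_dirichlet symbol.compact_composition symbol.absolutely_summing
  by (intro exI[of _ symbol]) auto

end
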